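(* Let $c<d$ be real numbers and $\alpha\in[c,d]$. Let $G_\alpha:\mathfrak S_\alpha\to\widehat T_{\mathfrak I}$ be the map sending each element $(t,(\mathrm L)\int_\alpha^tf\,d\mu)$ of $\mathfrak S_{\alpha,f}$ to the element $([\alpha,t],\widehat T_\alpha^t(f))$ of $\widehat T_{\mathfrak I}(f)$, and let $G^\natural(S,r)=([c,d],r)$. Suppose the category is $\mathscr A^1$ over $\mathbb R$ satisfying the L-condition. Then: (1) For any $(\beta,(\mathrm L)\int_\alpha^\beta f\,d\mu)\in\mathfrak S_{\alpha,f}$ and any real number $\gamma$ with $\beta\le\gamma\le d$, $$G^\natural\circ G\Big(\beta,(\mathrm L)\int_\alpha^\beta f\,d\mu\Big)+G^\natural\circ G\Big(\gamma,(\mathrm L)\int_\beta^\gamma f\,d\mu\Big)=G^\natural\circ G\Big(\gamma,(\mathrm L)\int_\alpha^\gamma f\,d\mu\Big),$$ where $G$ is $G_\alpha$ on the first and third arguments and $G_\beta$ on the second. (2) The map $G^\natural_\alpha:=G^\natural|_{\operatorname{Im}(G_\alpha)}$ is $\mathbb R$-linear: for any $k_1,k_2\in\mathbb R$, $\tilde f:=(\beta,(\mathrm L)\int_\alpha^\beta f\,d\mu)\in\mathfrak S_{\alpha,f}$ and $\tilde g:=(\beta,(\mathrm L)\int_\alpha^\beta g\,d\mu)\in\mathfrak S_{\alpha,g}$, $$G^\natural_\alpha\big(k_1G_\alpha(\tilde f)+k_2G_\alpha(\tilde g)\big)=k_1\cdot G^\natural_\alpha\circ G_\alpha(\tilde f)+k_2\cdot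 G^\natural_\alpha\circ G_\alpha(\tilde g).$$
   Context: L-condition (over $\mathbb R$): $p=1$, $\Bbbk=\Lambda=\mathbb R$, $\tau=\mathrm{id}_{\mathbb R}$, $\mathbb I=[c,d]$, midpoint subdivision $\xi=\frac{c+d}2$, $\kappa_c(x)=\frac{x+c}2$, $\kappa_d(x)=\frac{x+d}2$, and $\mu$ is Lebesgue measure; similarly for each subinterval of $[c,d]$. $\Sigma([c,d])$ is the $\sigma$-algebra generated by all subintervals of $[c,d]$. $\widehat{\mathbf S_{\mathrm{id}_{\mathbb R}}([c,d])}$ is the completion, in the norm $\|\sum_ik_i\mathbf 1_{X_i}\|=\sum_i|k_i|\mu(X_i)$ ($X_i$ disjoint intervals), of the space of a.e.-classes of step functions on $[c,d]$; it is identified with $L^1([c,d])$. The category $\mathscr A^1$ attached to an interval $[s,t]$ has as objects triples $(N,v,\delta)$, $N$ a real Banach space, $v\in N$, $\|v\|\le t-s$, and $\delta:N\oplus N\to N$ a suitable linear map with $\delta(v,v)=v$; morphisms are linear maps preserving this structure. $\widehat T_s^t$ denotes the unique morphism from the initial object $(\widehat{\mathbf S_{\mathrm{id}_{\mathbb R}}([s,t])},\mathbf 1_{[s,t]},\widehat\gamma)$ (with $\gamma$ juxtaposition of functions) to $(\mathbb R,t-s,m)$; it is known that $\widehat T_s^t(f)=(\mathrm L)\int_s^tf\,d\mu$, the Lebesgue integral. For $\alpha\in[c,d]$ let $\mathfrak I=\{[\alpha,t]:\alpha\le t\le d\}$, and for $f\in\widehat{\mathbf S_{\mathrm{id}_{\mathbb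 R}}([c,d])}$ let $\mathfrak S_{\alpha,f}=\{(t,(\mathrm L)\int_\alpha^tf\,d\mu)\in\mathbb R\times\mathbb R:\alpha\le t\le d\}$ and $\widehat T_{\mathfrak I}(f)=\{([\alpha,t],\widehat T_\alpha^t(f)):\alpha\le t\le d\}\subseteq\Sigma([c,d])\times\mathbb R$. Put $\mathfrak S_\alpha=\biguplus_f\mathfrak S_{\alpha,f}$ and $\widehat T_{\mathfrak I}=\biguplus_f\widehat T_{\mathfrak I}(f)$ (disjoint unions over $f$). Operations: pairs are added by $([u,v],\widehat T_u^v(f))+([s,t],\widehat T_s^t(g))=([y_1,y_2],\widehat T_{y_1}^{y_2}(\mathbf 1_{[u,v]}f+\mathbf 1_{[s,t]}g))$, $y_1=\min\{u,v,s,t\}$, $y_2=\max\{u,v,s,t\}$, and multiplied by scalars by $k(S,r)=(S,kr)$. On $\{[c,d]\}\times\mathbb R$: $([c,d],r_1)+([c,d],r_2)=([c,d],r_1+r_2)$, $k([c,d],r)=([c,d],kr)$. *)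

theory Defs
  imports "HOL-Analysis.Analysis"
begin

section \<open>The category attached to an interval\<close>

text \<open>
  Normed spaces are given with an explicit carrier, because the space attached to an interval
  below depends on the end points of that interval.
\<close>

record 'a nspace =
  ncarrier :: "'a set"
  nadd :: "'a \<Rightarrow> 'a \<Rightarrow> 'a"
  nscale :: "real \<Rightarrow> 'a \<Rightarrow> 'a"
  nzero :: 'a
  nnorm :: "'a \<Rightarrow> real"

record 'a triple = "'a nspace" +
  npoint :: 'a
  nglue :: "'a \<Rightarrow> 'a \<Rightarrow> 'a"

definition real_vector_space_rec :: "('a, 'b) nspace_scheme \<Rightarrow> bool" where
  "real_vector_space_rec N \<longleftrightarrow>
     nzero N \<in> ncarrier N \<and>
     (\<forall>x\<in>ncarrier N. \<forall>y\<in>ncarrier N. nadd N x y \<in> ncarrier N) \<and>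
     (\<forall>k. \<forall>x\<in>ncarrier N. nscale N k x \<in> ncarrier N) \<and>
     (\<forall>x\<in>ncarrier N. \<forall>y\<in>ncarrier N. \<forall>z\<in>ncarrier N.
        nadd N (nadd N x y) z = nadd N x (nadd N y z)) \<and>
     (\<forall>x\<in>ncarrier N. \<forall>y\<in>ncarrier N. nadd N x y = nadd N y x) \<and>
     (\<forall>x\<in>ncarrier N. nadd N (nzero N) x = x) \<and>
     (\<forall>x\<in>ncarrier N. \<exists>y\<in>ncarrier N. nadd N x y = nzero N) \<and>
     (\<forall>k. \<forall>x\<in>ncarrier N. \<forall>y\<in>ncarrier N.
        nscale N k (nadd N x y) = nadd N (nscale N k x) (nscale N k y)) \<and>
     (\<forall>k l. \<forall>x\<in>ncarrier N. nscale N (k + l) x = nadd N (nscale N k x) (nscale N l x)) \<and>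
     (\<forall>k l. \<forall>x\<in>ncarrier N. nscale N k (nscale N l x) = nscale N (k * l) x) \<and>
     (\<forall>x\<in>ncarrier N. nscale N 1 x = x)"

definition real_normed_space_rec :: "('a, 'b) nspace_scheme \<Rightarrow> bool" where
  "real_normed_space_rec N \<longleftrightarrow>
     real_vector_space_rec N \<and>
     (\<forall>x\<in>ncarrier N. 0 \<le> nnorm N x) \<and>
     (\<forall>x\<in>ncarrier N. nnorm N x = 0 \<longleftrightarrow> x = nzero N) \<and>
     (\<forall>k. \<forall>x\<in>ncarrier N. nnorm N (nscale N k x) = \<bar>k\<bar> * nnorm N x) \<and>
     (\<forall>x\<in>ncarrier N. \<forall>y\<in>ncarrier N. nnorm N (nadd N x y) \<le> nnorm N x + nnorm N y)"

definition ndist :: "('a, 'b) nspace_scheme \<Rightarrow> 'a \<Rightarrow> 'a \<Rightarrow> real" where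
  "ndist N x y = nnorm N (nadd N x (nscale N (- 1) y))"

definition real_banach_space_rec :: "('a, 'b) nspace_scheme \<Rightarrow> bool" where
  "real_banach_space_rec N \<longleftrightarrow>
     real_normed_space_rec N \<and>
     (\<forall>\<sigma> :: nat \<Rightarrow> 'a. (\<forall>n. \<sigma> n \<in> ncarrier N) \<and>
        (\<forall>e>0. \<exists>M. \<forall>m\<ge>M. \<forall>n\<ge>M. ndist N (\<sigma> m) (\<sigma> n) < e) \<longrightarrow>
        (\<exists>x\<in>ncarrier N. (\<lambda>n. ndist N (\<sigma> n) x) \<longlonglongrightarrow> 0))"

text \<open>
  Objects.  For midpoint subdivision and \<open>p = 1\<close>, both halves of the interval have weight
  one half in the norm of \<open>N \<oplus> N\<close>, i.e. that norm is \<open>(\<parallel>x\<parallel> + \<parallel>y\<parallel>) / 2\<close>.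
  The structure map is a linear map \<open>N \<oplus> N \<rightarrow> N\<close>, written as a function of two
  arguments, that does not increase norms.
\<close>

definition A1_obj :: "real \<Rightarrow> real \<Rightarrow> 'a triple \<Rightarrow> bool" where
  "A1_obj s t N \<longleftrightarrow>
     real_banach_space_rec N \<and>
     npoint N \<in> ncarrier N \<and> nnorm N (npoint N) \<le> t - s \<and>
     (\<forall>x\<in>ncarrier N. \<forall>y\<in>ncarrier N. nglue N x y \<in> ncarrier N) \<and>
     (\<forall>x\<in>ncarrier N. \<forall>y\<in>ncarrier N. \<forall>x'\<in>ncarrier N. \<forall>y'\<in>ncarrier N.
        nglue N (nadd N x x') (nadd N y y') = nadd N (nglue N x y) (nglue N x' y')) \<and>
     (\<forall>k. \<forall>x\<in>ncarrier N. \<forall>y\<in>ncarrier N.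
        nglue N (nscale N k x) (nscale N k y) = nscale N k (nglue N x y)) \<and>
     (\<forall>x\<in>ncarrier N. \<forall>y\<in>ncarrier N. nnorm N (nglue N x y) \<le> (nnorm N x + nnorm N y) / 2) \<and>
     nglue N (npoint N) (npoint N) = npoint N"

text \<open>
  Morphisms: bounded linear maps preserving the point and commuting with the structure maps.
  They are extensional, so that equality of morphisms is equality on the carrier.
\<close>

definition A1_hom :: "real \<Rightarrow> real \<Rightarrow> 'a triple \<Rightarrow> 'b triple \<Rightarrow> ('a \<Rightarrow> 'b) set" where
  "A1_hom s t N N' = {\<theta> \<in> ncarrier N \<rightarrow>\<^sub>E ncarrier N'.
     A1_obj s t N \<and> A1_obj s t N' \<and>
     (\<forall>x\<in>ncarrier N. \<forall>y\<in>ncarrier N. \<theta> (nadd N x y) = nadd N' (\<theta> x) (\<theta> y)) \<and>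
     (\<forall>k. \<forall>x\<in>ncarrier N. \<theta> (nscale N k x) = nscale N' k (\<theta> x)) \<and>
     (\<exists>B. \<forall>x\<in>ncarrier N. nnorm N' (\<theta> x) \<le> B * nnorm N x) \<and>
     \<theta> (npoint N) = npoint N' \<and>
     (\<forall>x\<in>ncarrier N. \<forall>y\<in>ncarrier N. \<theta> (nglue N x y) = nglue N' (\<theta> x) (\<theta> y))}"

text \<open>The object \<open>(\<real>, t - s, m)\<close>, where \<open>m\<close> is the arithmetic mean.\<close>

definition real_obj :: "real \<Rightarrow> real \<Rightarrow> real triple" where
  "real_obj s t = \<lparr> ncarrier = UNIV, nadd = (+), nscale = (*), nzero = 0, nnorm = abs,
     npoint = t - s, nglue = (\<lambda>x y. (x + y) / 2) \<rparr>"


section \<open>The completed space of step functions\<close>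

text \<open>
  An a.e.-class on \<open>[s,t]\<close> is a set of functions on \<open>\<real>\<close>; the values outside
  \<open>[s,t]\<close> are irrelevant.
\<close>

definition ae_class :: "real \<Rightarrow> real \<Rightarrow> (real \<Rightarrow> real) \<Rightarrow> (real \<Rightarrow> real) set" where
  "ae_class s t f = {g. AE x in lebesgue_on {s..t}. g x = f x}"

definition rep :: "(real \<Rightarrow> real) set \<Rightarrow> real \<Rightarrow> real" where
  "rep F = (SOME f. f \<in> F)"

definition step_function :: "real \<Rightarrow> real \<Rightarrow> (real \<Rightarrow> real) \<Rightarrow> bool" where
  "step_function s t f \<longleftrightarrow>
     (\<exists>(\<X> :: real set set) k. finite \<X> \<and> disjoint \<X> \<and>
        (\<forall>X\<in>\<X>. is_interval X \<and> X \<subseteq> {s..t}) \<and>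
        (\<forall>x\<in>{s..t}. f x = (\<Sum>X\<in>\<X>. k X * indicator X x)))"

text \<open>
  The norm \<open>\<Sum>i. \<bar>k\<^sub>i\<bar> * \<mu> X\<^sub>i\<close> of a step function is the integral of its
  absolute value.  The completion for this norm is realised as the closure of the classes of step
  functions in the (complete) space of classes of Lebesgue integrable functions, which is all of
  that space.
\<close>

definition Shat :: "real \<Rightarrow> real \<Rightarrow> (real \<Rightarrow> real) set set" where
  "Shat s t = {ae_class s t f | f.
     integrable (lebesgue_on {s..t}) f \<and>
     (\<forall>e>0. \<exists>g. step_function s t g \<and> (\<integral>x. \<bar>f x - g x\<bar> \<partial>lebesgue_on {s..t}) < e)}"

definition cl_add :: "real \<Rightarrow> real \<Rightarrow> (real \<Rightarrow> real) set \<Rightarrow> (real \<Rightarrow> real) set \<Rightarrow> (real \<Rightarrow> real) set" where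
  "cl_add s t F G = ae_class s t (\<lambda>x. rep F x + rep G x)"

definition cl_scale :: "real \<Rightarrow> real \<Rightarrow> real \<Rightarrow> (real \<Rightarrow> real) set \<Rightarrow> (real \<Rightarrow> real) set" where
  "cl_scale s t k F = ae_class s t (\<lambda>x. k * rep F x)"

definition cl_cut :: "real \<Rightarrow> real \<Rightarrow> real set \<Rightarrow> (real \<Rightarrow> real) set \<Rightarrow> (real \<Rightarrow> real) set" where
  "cl_cut s t A F = ae_class s t (\<lambda>x. indicator A x * rep F x)"

definition cl_restrict :: "real \<Rightarrow> real \<Rightarrow> (real \<Rightarrow> real) set \<Rightarrow> (real \<Rightarrow> real) set" where
  "cl_restrict s t F = ae_class s t (rep F)"

text \<open>
  Juxtaposition: the left half carries \<open>f \<circ> \<kappa>\<^sub>s\<^sup>-\<^sup>1\<close> and the right half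
  \<open>g \<circ> \<kappa>\<^sub>t\<^sup>-\<^sup>1\<close>, where \<open>\<kappa>\<^sub>s x = (x + s) / 2\<close> and
  \<open>\<kappa>\<^sub>t x = (x + t) / 2\<close>.
\<close>

definition juxtapose :: "real \<Rightarrow> real \<Rightarrow> (real \<Rightarrow> real) \<Rightarrow> (real \<Rightarrow> real) \<Rightarrow> real \<Rightarrow> real" where
  "juxtapose s t f g = (\<lambda>x. if x < (s + t) / 2 then f (2 * x - s) else g (2 * x - t))"

definition Shat_obj :: "real \<Rightarrow> real \<Rightarrow> (real \<Rightarrow> real) set triple" where
  "Shat_obj s t = \<lparr> ncarrier = Shat s t, nadd = cl_add s t, nscale = cl_scale s t,
     nzero = ae_class s t (\<lambda>x. 0),
     nnorm = (\<lambda>F. \<integral>x. \<bar>rep F x\<bar> \<partial>lebesgue_on {s..t}),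
     npoint = ae_class s t (indicator {s..t}),
     nglue = (\<lambda>F G. ae_class s t (juxtapose s t (rep F) (rep G))) \<rparr>"

definition T_hat :: "real \<Rightarrow> real \<Rightarrow> (real \<Rightarrow> real) set \<Rightarrow> real" where
  "T_hat s t = (THE \<theta>. \<theta> \<in> A1_hom s t (Shat_obj s t) (real_obj s t))"


section \<open>The two families and the maps between them\<close>

text \<open>
  In this section an element \<open>F\<close> of \<open>Shat c d\<close> is also used on subintervals \<open>[s,t]\<close>
  of \<open>[c,d]\<close>, through its restriction.
\<close>

definition L_int :: "real \<Rightarrow> real \<Rightarrow> (real \<Rightarrow> real) set \<Rightarrow> real" where
  "L_int s t F = (\<integral>x. rep F x \<partial>lebesgue_on {s..t})"

definition T_sub :: "real \<Rightarrow> real \<Rightarrow> (real \<Rightarrow> real) set \<Rightarrow> real" where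
  "T_sub s t F = T_hat s t (cl_restrict s t F)"

definition S_fib :: "real \<Rightarrow> real \<Rightarrow> (real \<Rightarrow> real) set \<Rightarrow> (real \<times> real) set" where
  "S_fib d \<alpha> F = {(t, L_int \<alpha> t F) | t. \<alpha> \<le> t \<and> t \<le> d}"

definition T_fib :: "real \<Rightarrow> real \<Rightarrow> (real \<Rightarrow> real) set \<Rightarrow> (real set \<times> real) set" where
  "T_fib d \<alpha> F = {({\<alpha>..t}, T_sub \<alpha> t F) | t. \<alpha> \<le> t \<and> t \<le> d}"

text \<open>The disjoint unions consist of pairs whose first component is the index.\<close>

definition S_union :: "real \<Rightarrow> real \<Rightarrow> real \<Rightarrow> ((real \<Rightarrow> real) set \<times> real \<times> real) set" where
  "S_union c d \<alpha> = (SIGMA F:Shat c d. S_fib d \<alpha> F)"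

definition T_union :: "real \<Rightarrow> real \<Rightarrow> real \<Rightarrow> ((real \<Rightarrow> real) set \<times> real set \<times> real) set" where
  "T_union c d \<alpha> = (SIGMA F:Shat c d. T_fib d \<alpha> F)"

definition interval_algebra :: "real \<Rightarrow> real \<Rightarrow> real set set" where
  "interval_algebra c d = sigma_sets {c..d} {X. is_interval X \<and> X \<subseteq> {c..d}}"

lemma T_fib_subset: "c \<le> \<alpha> \<Longrightarrow> T_fib d \<alpha> F \<subseteq> interval_algebra c d \<times> UNIV"
  unfolding T_fib_def interval_algebra_def
  by (auto intro!: sigma_sets.Basic simp: is_interval_cc)

definition G_map :: "real \<Rightarrow> real \<Rightarrow> real \<Rightarrow>
    (real \<Rightarrow> real) set \<times> real \<times> real \<Rightarrow> (real \<Rightarrow> real) set \<times> real set \<times> real" where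
  "G_map c d \<alpha> = (\<lambda>(F, t, r)\<in>S_union c d \<alpha>. (F, {\<alpha>..t}, T_sub \<alpha> t F))"

lemma G_map_funcset: "G_map c d \<alpha> \<in> S_union c d \<alpha> \<rightarrow>\<^sub>E T_union c d \<alpha>"
  by (auto simp: G_map_def S_union_def T_union_def S_fib_def T_fib_def)

definition G_nat :: "real \<Rightarrow> real \<Rightarrow> (real \<Rightarrow> real) set \<times> real set \<times> real \<Rightarrow> real set \<times> real" where
  "G_nat c d = (\<lambda>(F, S, r). ({c..d}, r))"

definition G_nat_res :: "real \<Rightarrow> real \<Rightarrow> real \<Rightarrow>
    (real \<Rightarrow> real) set \<times> real set \<times> real \<Rightarrow> real set \<times> real" where
  "G_nat_res c d \<alpha> = restrict (G_nat c d) (G_map c d \<alpha> ` S_union c d \<alpha>)"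

text \<open>
  Operations on pairs with an interval as first component.  The index is carried along: it is
  \<open>1\<^bsub>[u,v]\<^esub> f + 1\<^bsub>[s,t]\<^esub> g\<close> for the sum, whose second component is computed from
  it, and \<open>k f\<close> for the scalar multiple.  The end points of a nonempty interval
  \<open>{u..v}\<close> are recovered as its infimum and supremum.
\<close>

definition pair_add :: "real \<Rightarrow> real \<Rightarrow>
    (real \<Rightarrow> real) set \<times> real set \<times> real \<Rightarrow> (real \<Rightarrow> real) set \<times> real set \<times> real \<Rightarrow>
    (real \<Rightarrow> real) set \<times> real set \<times> real" where
  "pair_add c d = (\<lambda>(F, S, r) (G, S', r').
     let y1 = Min {Inf S, Sup S, Inf S', Sup S'};
         y2 = Max {Inf S, Sup S, Inf S', Sup S'};
         H = cl_add c d (cl_cut c d S F) (cl_cut c d S' G)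
     in (H, {y1..y2}, T_sub y1 y2 H))"

definition pair_scale :: "real \<Rightarrow> real \<Rightarrow> real \<Rightarrow>
    (real \<Rightarrow> real) set \<times> real set \<times> real \<Rightarrow> (real \<Rightarrow> real) set \<times> real set \<times> real" where
  "pair_scale c d k = (\<lambda>(F, S, r). (cl_scale c d k F, S, k * r))"

text \<open>Operations on \<open>{[c,d]} \<times> \<real>\<close>.\<close>

definition top_add :: "real \<Rightarrow> real \<Rightarrow> real set \<times> real \<Rightarrow> real set \<times> real \<Rightarrow> real set \<times> real" where
  "top_add c d = (\<lambda>(S, r) (S', r'). ({c..d}, r + r'))"

definition top_scale :: "real \<Rightarrow> real \<Rightarrow> real \<Rightarrow> real set \<times> real \<Rightarrow> real set \<times> real" where
  "top_scale c d k = (\<lambda>(S, r). ({c..d}, k * r))"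

end

theory Submission
  imports Defs
begin

text \<open>
  Both claims are properties of the real-valued components \<open>T_sub s t F\<close>, and they are the
  additivity over adjacent intervals and the linearity of the Lebesgue integral as soon as
  \<open>T_hat s t\<close> is known to be integration over \<open>[s,t]\<close>.  So the substance is
  that integration is the one and only morphism from the space of step function classes to
  \<open>(\<real>, t - s, m)\<close> (\<open>T_hat_eq_L_int\<close>).

  Existence requires the source to be an object of the category.  Its completeness follows from the
  completeness of the \<open>L\<^sup>1\<close> norm (\<open>L1_complete\<close>) because limits of step functions
  are closed under \<open>L\<^sup>1\<close> limits.  For the algebraic operations, which are Lipschitz
  continuous in that norm, it suffices that step functions themselves are preserved.  Here it is
  convenient that a function on \<open>[s,t]\<close> is a step function iff it only depends on the position
  of its argument relative to finitely many points (\<open>step_function_iff_same_cell\<close>).  That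
  integration commutes with the structure maps is the change of variables \<open>x \<mapsto> 2 * x - s\<close>
  and \<open>x \<mapsto> 2 * x - t\<close> on the two halves (\<open>integral_juxtapose\<close>).

  For uniqueness (\<open>A1_hom_Shat_eq_integral\<close>) let \<open>\<Phi>\<close> be the difference of a
  morphism and the integral, and put \<open>h x = \<Phi> (indicator {s..x})\<close>.  Then \<open>\<Phi>\<close> is bounded
  and linear, vanishes at \<open>indicator {s..t}\<close>, and takes juxtapositions to means.  The
  indicator of \<open>{s..x}\<close> is a juxtaposition of \<open>indicator {s..2 * x - s}\<close> and \<open>0\<close>
  if \<open>x\<close> is in the left half, and of \<open>indicator {s..t}\<close> and
  \<open>indicator {s..2 * x - t}\<close> otherwise.  Either way \<open>\<bar>h\<bar>\<close> at \<open>x\<close> is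
  half of its value at a point of \<open>[s,t]\<close>.  A bounded function with this
  property is zero.  Hence \<open>\<Phi>\<close> vanishes on indicators of intervals, on step functions, and by
  continuity everywhere.
\<close>

section \<open>Lebesgue integrals and completeness in mean\<close>

lemma AE_lebesgue_neq: "AE x in lebesgue. x \<noteq> (a::real)"
  by (rule AE_completion) (rule AE_lborel_singleton)

text \<open>
  Since Lebesgue measure is complete, measurability passes to every function that is equal almost
  everywhere.  Hence every member of the a.e.-class of an integrable function can be integrated.
\<close>

lemma integrable_cong_AE_lebesgue:
  fixes f g :: "real \<Rightarrow> real"
  assumes "integrable lebesgue f" and "AE x in lebesgue. f x = g x"
  shows "integrable lebesgue g" and "(\<integral>x. g x \<partial>lebesgue) = (\<integral>x. f x \<partial>lebesgue)"
proof -
  have f: "f \<in> borel_measurable lebesgue"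
    using assms(1) by blast
  have g: "g \<in> borel_measurable lebesgue"
    using borel_measurable_AE[OF f assms(2)] .
  show "integrable lebesgue g"
    using integrable_cong_AE_imp[OF assms(1) g assms(2)] .
  show "(\<integral>x. g x \<partial>lebesgue) = (\<integral>x. f x \<partial>lebesgue)"
    using integral_cong_AE[OF f g assms(2)] by simp
qed

lemma integrable_cong_AE_lebesgue_on:
  fixes f g :: "real \<Rightarrow> real"
  assumes "integrable (lebesgue_on {s..t}) f" and "AE x in lebesgue_on {s..t}. f x = g x"
  shows "integrable (lebesgue_on {s..t}) g"
    and "(\<integral>x. g x \<partial>lebesgue_on {s..t}) = (\<integral>x. f x \<partial>lebesgue_on {s..t})"
proof -
  have "integrable lebesgue (\<lambda>x. indicator {s..t} x *\<^sub>R f x)"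
    using assms(1) by (simp add: integrable_restrict_space)
  moreover have "AE x in lebesgue. indicator {s..t} x *\<^sub>R f x = indicator {s..t} x *\<^sub>R g x"
    using assms(2) by (simp add: AE_restrict_space_iff) (auto simp: indicator_def)
  ultimately have "integrable lebesgue (\<lambda>x. indicator {s..t} x *\<^sub>R g x)"
    and "(\<integral>x. indicator {s..t} x *\<^sub>R g x \<partial>lebesgue) = (\<integral>x. indicator {s..t} x *\<^sub>R f x \<partial>lebesgue)"
    by (rule integrable_cong_AE_lebesgue)+
  then show "integrable (lebesgue_on {s..t}) g"
    and "(\<integral>x. g x \<partial>lebesgue_on {s..t}) = (\<integral>x. f x \<partial>lebesgue_on {s..t})"
    by (simp_all add: integrable_restrict_space integral_restrict_space)
qed

lemma integral_abs_triangle: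
  fixes f g h :: "'a \<Rightarrow> real"
  assumes "integrable M f" "integrable M g" "integrable M h"
  shows "(\<integral>x. \<bar>f x - h x\<bar> \<partial>M) \<le> (\<integral>x. \<bar>f x - g x\<bar> \<partial>M) + (\<integral>x. \<bar>g x - h x\<bar> \<partial>M)"
proof -
  have "(\<integral>x. \<bar>f x - h x\<bar> \<partial>M) \<le> (\<integral>x. \<bar>f x - g x\<bar> + \<bar>g x - h x\<bar> \<partial>M)"
    using assms by (intro integral_mono) auto
  then show ?thesis
    using assms by simp
qed

text \<open>
  The Riesz--Fischer argument: along a subsequence whose consecutive \<open>L\<^sup>1\<close> distances are
  at most \<open>(1 / 2) ^ k\<close>, the telescoping series of differences converges absolutely almost
  everywhere, and the \<open>L\<^sup>1\<close> norms of its tails are bounded by geometric tails.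
\<close>

lemma L1_complete:
  fixes u :: "nat \<Rightarrow> 'a \<Rightarrow> real"
  assumes int: "\<And>n. integrable M (u n)"
    and cauchy: "\<And>e. e > 0 \<Longrightarrow> \<exists>N. \<forall>m\<ge>N. \<forall>n\<ge>N. (\<integral>x. \<bar>u m x - u n x\<bar> \<partial>M) < e"
  obtains f where "integrable M f" and "(\<lambda>n. \<integral>x. \<bar>u n x - f x\<bar> \<partial>M) \<longlonglongrightarrow> 0"
proof -
  have "\<forall>k. \<exists>N. \<forall>m\<ge>N. \<forall>n\<ge>N. (\<integral>x. \<bar>u m x - u n x\<bar> \<partial>M) < (1 / 2) ^ k"
    by (intro allI cauchy) simp
  then obtain N where N: "\<And>k m n. m \<ge> N k \<Longrightarrow> n \<ge> N k \<Longrightarrow>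
      (\<integral>x. \<bar>u m x - u n x\<bar> \<partial>M) < (1 / 2) ^ k"
    by metis
  \<comment> \<open>\<open>N\<close> need not be monotone; the maximum makes both \<open>r k\<close> and \<open>r (Suc k)\<close> at least \<open>N k\<close>.\<close>
  define r where "r k = Max (N ` {..k})" for k
  have r: "N j \<le> r k" if "j \<le> k" for j k
    unfolding r_def using that by (intro Max_ge) auto
  define d where "d k x = u (r (Suc k)) x - u (r k) x" for k x
  have d_int[simp]: "integrable M (d k)" for k
    unfolding d_def using int by simp
  have d_meas[measurable]: "d k \<in> borel_measurable M" for k
    using d_int by (rule borel_measurable_integrable)
  have d_bound: "(\<integral>x. \<bar>d k x\<bar> \<partial>M) \<le> (1 / 2) ^ k" for k
    unfolding d_def using N[of k "r (Suc k)" "r k"] r by (simp add: less_imp_le)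
  have geom: "summable (\<lambda>k. (1 / 2) ^ (k + n) :: real)" for n
    by (subst summable_iff_shift) (simp add: summable_geometric)
  have d_sum: "summable (\<lambda>k. \<integral>x. \<bar>d (k + n) x\<bar> \<partial>M)" for n
    by (rule summable_comparison_test'[OF geom[of n], of 0]) (use d_bound in \<open>simp add: integral_nonneg_AE\<close>)
  have "AE x in M. (\<Sum>k. ennreal \<bar>d k x\<bar>) \<noteq> \<infinity>"
  proof (rule nn_integral_PInf_AE)
    have "(\<integral>\<^sup>+x. (\<Sum>k. ennreal \<bar>d k x\<bar>) \<partial>M) = (\<Sum>k. \<integral>\<^sup>+x. ennreal \<bar>d k x\<bar> \<partial>M)"
      by (intro nn_integral_suminf) measurable
    also have "\<dots> = (\<Sum>k. ennreal (\<integral>x. \<bar>d k x\<bar> \<partial>M))"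
      by (simp add: nn_integral_eq_integral)
    also have "\<dots> \<noteq> \<infinity>"
      unfolding infinity_ennreal_def
      by (rule ennreal_suminf_neq_top) (use d_sum[of 0] in simp_all)
    finally show "(\<integral>\<^sup>+x. (\<Sum>k. ennreal \<bar>d k x\<bar>) \<partial>M) \<noteq> \<infinity>" .
  qed measurable
  then have abs_summable: "AE x in M. summable (\<lambda>k. \<bar>d k x\<bar>)"
    by eventually_elim (auto intro: summable_suminf_not_top)
  then have abs_summable_shift: "AE x in M. summable (\<lambda>k. norm (d (k + n) x))" for n
    by eventually_elim (simp add: summable_iff_shift[where f = "\<lambda>k. \<bar>d k _\<bar>"])
  define f where "f x = u (r 0) x + (\<Sum>k. d k x)" for x
  have f_int: "integrable M f"
    unfolding f_def
    using abs_summable_shift[of 0] d_sum[of 0] int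
    by (intro Bochner_Integration.integrable_add integrable_suminf) simp_all
  have tail: "(\<integral>x. \<bar>u (r n) x - f x\<bar> \<partial>M) \<le> 2 * (1 / 2) ^ n" for n
  proof -
    have abs_int: "integrable M (\<lambda>x. \<Sum>k. \<bar>d (k + n) x\<bar>)"
      "(\<integral>x. (\<Sum>k. \<bar>d (k + n) x\<bar>) \<partial>M) = (\<Sum>k. \<integral>x. \<bar>d (k + n) x\<bar> \<partial>M)"
      using abs_summable_shift[of n] d_sum[of n]
      by (auto intro!: integrable_suminf integral_suminf)
    have "(\<integral>x. \<bar>u (r n) x - f x\<bar> \<partial>M) \<le> (\<integral>x. (\<Sum>k. \<bar>d (k + n) x\<bar>) \<partial>M)"
    proof (rule integral_mono_AE)
      show "AE x in M. \<bar>u (r n) x - f x\<bar> \<le> (\<Sum>k. \<bar>d (k + n) x\<bar>)"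
        using abs_summable abs_summable_shift[of n]
      proof eventually_elim
        case (elim x)
        have "(\<Sum>k<n. d k x) = u (r n) x - u (r 0) x"
          unfolding d_def by (rule sum_lessThan_telescope)
        moreover have "(\<Sum>k. d k x) = (\<Sum>k. d (k + n) x) + (\<Sum>k<n. d k x)"
          using elim by (intro suminf_split_initial_segment) (simp add: summable_rabs_cancel)
        ultimately have "\<bar>u (r n) x - f x\<bar> = \<bar>\<Sum>k. d (k + n) x\<bar>"
          by (simp add: f_def)
        also have "\<dots> \<le> (\<Sum>k. \<bar>d (k + n) x\<bar>)"
          using elim by (intro summable_rabs) simp
        finally show ?case .
      qed
    qed (use int f_int abs_int in auto)
    also have "\<dots> \<le> (\<Sum>k. (1 / 2) ^ (k + n))"
      unfolding abs_int(2) by (intro suminf_le d_bound d_sum geom)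
    also have "\<dots> = 2 * (1 / 2) ^ n"
      using suminf_mult2[OF summable_geometric[of "1 / 2 :: real"], of "(1 / 2) ^ n"]
      by (simp add: power_add suminf_geometric)
    finally show ?thesis .
  qed
  have "(\<lambda>n. \<integral>x. \<bar>u n x - f x\<bar> \<partial>M) \<longlonglongrightarrow> 0"
  proof (rule LIMSEQ_I)
    fix e :: real assume "e > 0"
    then obtain k where k: "(1 / 2) ^ k < e / 3"
      using real_arch_pow_inv[of "e / 3" "1 / 2"] by auto
    have "(\<integral>x. \<bar>u n x - f x\<bar> \<partial>M) < e" if "n \<ge> N k" for n
      using integral_abs_triangle[OF int[of n] int[of "r k"] f_int] tail[of k]
        N[OF that r[of k k]] k by simp
    then show "\<exists>n0. \<forall>n\<ge>n0. norm ((\<integral>x. \<bar>u n x - f x\<bar> \<partial>M) - 0) < e"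
      by (intro exI[of _ "N k"]) (simp add: integral_nonneg_AE)
  qed
  with f_int show ?thesis
    using that by blast
qed

section \<open>Step functions\<close>

text \<open>
  A finite set \<open>P\<close> cuts the line into its points and the open gaps between them.  Points in
  the same of these cells are characterised without sorting \<open>P\<close>.
\<close>

definition same_cell :: "real set \<Rightarrow> real \<Rightarrow> real \<Rightarrow> bool" where
  "same_cell P x y \<longleftrightarrow> (\<forall>p\<in>P. (p \<le> x \<longleftrightarrow> p \<le> y) \<and> (p < x \<longleftrightarrow> p < y))"

text \<open>
  Families of disjoint intervals are awkward to combine, whereas a union of two finite sets of cut
  points serves two step functions at once.  In one direction the cut points are the end points of
  the given intervals; in the other the cells themselves are the disjoint intervals.
\<close>

lemma step_function_iff_same_cell:
  "step_function s t f \<longleftrightarrow>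
     (\<exists>P. finite P \<and> (\<forall>x\<in>{s..t}. \<forall>y\<in>{s..t}. same_cell P x y \<longrightarrow> f x = f y))"
proof
  assume "step_function s t f"
  then obtain \<X> :: "real set set" and k where \<X>: "finite \<X>" "\<And>X. X \<in> \<X> \<Longrightarrow> is_interval X"
      "\<And>X. X \<in> \<X> \<Longrightarrow> X \<subseteq> {s..t}"
    and f: "\<And>x. x \<in> {s..t} \<Longrightarrow> f x = (\<Sum>X\<in>\<X>. k X * indicator X x)"
    unfolding step_function_def by blast
  define P where "P = Inf ` \<X> \<union> Sup ` \<X>"
  have mem_mono: "y \<in> X"
    if X: "X \<in> \<X>" and "same_cell P x y" "x \<in> X" for X x y
  proof -
    have bdd: "bdd_above X" "bdd_below X"
      using \<X>(3)[OF X] by (auto intro: bdd_above_mono bdd_below_mono)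
    have "Inf X \<in> P" "Sup X \<in> P"
      using X by (auto simp: P_def)
    then have cell: "Inf X < x \<longleftrightarrow> Inf X < y" "Inf X \<le> x \<longleftrightarrow> Inf X \<le> y"
        "Sup X < x \<longleftrightarrow> Sup X < y" "Sup X \<le> x \<longleftrightarrow> Sup X \<le> y"
      using that(2) by (auto simp: same_cell_def)
    have x: "Inf X \<le> x" "x \<le> Sup X"
      using \<open>x \<in> X\<close> bdd by (auto intro: cInf_lower cSup_upper)
    show ?thesis
    proof (cases "x = Inf X \<or> x = Sup X")
      case True
      then have "y = x" using cell by force
      with \<open>x \<in> X\<close> show ?thesis by simp
    next
      case False
      then have "Inf X < y" "y < Sup X" using cell x by force+
      then obtain z w where "z \<in> X" "z < y" "w \<in> X" "y < w"
        using \<open>x \<in> X\<close> by (metis cInf_lessD less_cSupD empty_iff)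
      then show ?thesis
        using \<X>(2)[OF X] by (meson is_interval_1 less_imp_le)
    qed
  qed
  have "f x = f y" if "x \<in> {s..t}" "y \<in> {s..t}" "same_cell P x y" for x y
  proof -
    have "same_cell P y x" using that(3) by (auto simp: same_cell_def)
    then have "x \<in> X \<longleftrightarrow> y \<in> X" if "X \<in> \<X>" for X
      using mem_mono that \<open>same_cell P x y\<close> by blast
    then show ?thesis
      unfolding f[OF that(1)] f[OF that(2)] by (intro sum.cong) (auto simp: indicator_def)
  qed
  moreover have "finite P"
    unfolding P_def using \<X>(1) by blast
  ultimately show "\<exists>P. finite P \<and> (\<forall>x\<in>{s..t}. \<forall>y\<in>{s..t}. same_cell P x y \<longrightarrow> f x = f y)"
    by blast
next
  assume "\<exists>P. finite P \<and> (\<forall>x\<in>{s..t}. \<forall>y\<in>{s..t}. same_cell P x y \<longrightarrow> f x = f y)"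
  then obtain P where "finite P"
    and f: "\<And>x y. x \<in> {s..t} \<Longrightarrow> y \<in> {s..t} \<Longrightarrow> same_cell P x y \<Longrightarrow> f x = f y"
    by blast
  define cell where "cell x = {y \<in> {s..t}. same_cell P x y}" for x
  have cell_eq: "cell y = cell x" if "y \<in> cell x" for x y
    using that unfolding cell_def same_cell_def by auto
  have cell_self: "x \<in> cell x" if "x \<in> {s..t}" for x
    using that unfolding cell_def same_cell_def by auto
  \<comment> \<open>A cell is determined by the two subsets of \<open>P\<close> lying weakly and strictly below it.\<close>
  have "cell x = {y \<in> {s..t}. {p\<in>P. p \<le> y} = {p\<in>P. p \<le> x} \<and> {p\<in>P. p < y} = {p\<in>P. p < x}}" for x
    unfolding cell_def same_cell_def by auto
  then have "cell ` {s..t} \<subseteq>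
      (\<lambda>(A, B). {y \<in> {s..t}. {p\<in>P. p \<le> y} = A \<and> {p\<in>P. p < y} = B}) ` (Pow P \<times> Pow P)"
    by (auto intro!: image_eqI[where x = "({p\<in>P. p \<le> _}, {p\<in>P. p < _})"])
  then have fin: "finite (cell ` {s..t})"
    using \<open>finite P\<close> by (meson finite_Pow_iff finite_SigmaI finite_imageI finite_subset)
  have "disjoint (cell ` {s..t})"
    unfolding disjoint_def using cell_eq by blast
  moreover have "is_interval X \<and> X \<subseteq> {s..t}" if "X \<in> cell ` {s..t}" for X
    using that unfolding cell_def same_cell_def is_interval_1 by force
  moreover have "f x = (\<Sum>X\<in>cell ` {s..t}. f (SOME y. y \<in> X) * indicator X x)"
    if x: "x \<in> {s..t}" for x
  proof -
    have "(\<Sum>X\<in>cell ` {s..t}. f (SOME y. y \<in> X) * indicator X x)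
        = (\<Sum>X\<in>{cell x}. f (SOME y. y \<in> X) * indicator X x)"
      by (rule sum.mono_neutral_right) (use fin x cell_eq in \<open>auto simp: indicator_def\<close>)
    also have "\<dots> = f (SOME y. y \<in> cell x)"
      using cell_self[OF x] by simp
    also have "\<dots> = f x"
    proof (rule f[symmetric])
      have "(SOME y. y \<in> cell x) \<in> cell x"
        using cell_self[OF x] by (rule someI)
      then show "(SOME y. y \<in> cell x) \<in> {s..t}" "same_cell P x (SOME y. y \<in> cell x)"
        unfolding cell_def[of x] mem_Collect_eq by blast+
    qed (rule x)
    finally show ?thesis by simp
  qed
  ultimately show "step_function s t f"
    unfolding step_function_def
    using fin by (intro exI[of _ "cell ` {s..t}"] exI[of _ "\<lambda>X. f (SOME y. y \<in> X)"]) blast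
qed

lemma step_function_binop:
  assumes "step_function s t f" and "step_function s t g"
  shows "step_function s t (\<lambda>x. h (f x) (g x))"
proof -
  obtain P Q where "finite P" "finite Q"
    and "\<forall>x\<in>{s..t}. \<forall>y\<in>{s..t}. same_cell P x y \<longrightarrow> f x = f y"
    and "\<forall>x\<in>{s..t}. \<forall>y\<in>{s..t}. same_cell Q x y \<longrightarrow> g x = g y"
    using assms unfolding step_function_iff_same_cell by blast
  moreover have "same_cell P x y" "same_cell Q x y" if "same_cell (P \<union> Q) x y" for x y
    using that by (auto simp: same_cell_def)
  ultimately show ?thesis
    unfolding step_function_iff_same_cell by (intro exI[of _ "P \<union> Q"]) (simp; metis)
qed

lemma step_function_indicator:
  "step_function s t (indicator {a..b})"
proof -
  have "indicator {a..b} x = (indicator {a..b} y :: real)" if "same_cell {a, b} x y" for x y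
    using that by (simp add: same_cell_def indicator_def not_less[symmetric])
  then show ?thesis
    unfolding step_function_iff_same_cell by (intro exI[of _ "{a, b}"]) simp
qed

lemma step_function_subinterval:
  assumes "step_function c d f" and "{s..t} \<subseteq> {c..d}"
  shows "step_function s t f"
proof -
  obtain P where "finite P" "\<And>x y. x\<in>{c..d} \<Longrightarrow> y\<in>{c..d} \<Longrightarrow> same_cell P x y \<Longrightarrow> f x = f y"
    using assms(1) unfolding step_function_iff_same_cell by blast
  then show ?thesis
    unfolding step_function_iff_same_cell using subsetD[OF assms(2)] by (intro exI[of _ P]) simp
qed

text \<open>
  The cut points are moved into the two halves, and the midpoint is added to keep the halves
  apart.
\<close>

lemma step_function_juxtapose:
  assumes "step_function s t f" and "step_function s t g"
  shows "step_function s t (juxtapose s t f g)"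
proof -
  obtain P Q where PQ: "finite P" "finite Q"
    and f: "\<forall>x\<in>{s..t}. \<forall>y\<in>{s..t}. same_cell P x y \<longrightarrow> f x = f y"
    and g: "\<forall>x\<in>{s..t}. \<forall>y\<in>{s..t}. same_cell Q x y \<longrightarrow> g x = g y"
    using assms unfolding step_function_iff_same_cell by blast
  define R where "R = insert ((s + t) / 2) ((\<lambda>p. (p + s) / 2) ` P \<union> (\<lambda>p. (p + t) / 2) ` Q)"
  have "juxtapose s t f g x = juxtapose s t f g y"
    if "x \<in> {s..t}" "y \<in> {s..t}" "same_cell R x y" for x y
  proof (cases "x < (s + t) / 2")
    case True
    moreover have "y < (s + t) / 2"
      using that(3) True by (simp add: same_cell_def R_def not_le[symmetric])
    moreover have "same_cell P (2 * x - s) (2 * y - s)"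
      using that(3) by (simp add: same_cell_def R_def ball_Un algebra_simps)
    ultimately show ?thesis
      using that f[rule_format, of "2 * x - s" "2 * y - s"] by (simp add: juxtapose_def)
  next
    case False
    moreover have "\<not> y < (s + t) / 2"
      using that(3) False by (simp add: same_cell_def R_def not_le[symmetric])
    moreover have "same_cell Q (2 * x - t) (2 * y - t)"
      using that(3) by (simp add: same_cell_def R_def ball_Un algebra_simps)
    ultimately show ?thesis
      using that g[rule_format, of "2 * x - t" "2 * y - t"] by (simp add: juxtapose_def)
  qed
  moreover have "finite R"
    using PQ by (simp add: R_def)
  ultimately show ?thesis
    unfolding step_function_iff_same_cell by blast
qed

lemma integrable_indicator_interval:
  assumes "is_interval X" and "X \<subseteq> {s..t}"
  shows "integrable (lebesgue_on {s..t}) (indicator X :: real \<Rightarrow> real)"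
proof -
  have "X \<in> sets lebesgue"
    using real_interval_borel_measurable[OF assms(1)] by simp
  moreover have "emeasure lebesgue X < \<infinity>"
    using emeasure_mono[of X "{s..t}" lebesgue] assms(2)
    by (simp add: emeasure_lborel_Icc_eq split: if_splits) (metis ennreal_less_top le_less_trans not_less top.extremum_strict)
  ultimately show ?thesis
    using assms(2) by (simp add: integrable_restrict_space indicator_inter_arith[symmetric] Int_absorb1)
qed

lemma integrable_step_function:
  assumes "step_function s t f"
  shows "integrable (lebesgue_on {s..t}) f"
proof -
  obtain \<X> :: "real set set" and k where \<X>: "\<And>X. X \<in> \<X> \<Longrightarrow> is_interval X \<and> X \<subseteq> {s..t}"
    and f: "\<And>x. x \<in> {s..t} \<Longrightarrow> f x = (\<Sum>X\<in>\<X>. k X * indicator X x)"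
    using assms unfolding step_function_def by blast
  have "integrable (lebesgue_on {s..t}) (\<lambda>x. \<Sum>X\<in>\<X>. k X * indicator X x)"
    using \<X> by (intro Bochner_Integration.integrable_sum integrable_mult_right integrable_indicator_interval) auto
  moreover have "integrable (lebesgue_on {s..t}) f \<longleftrightarrow>
      integrable (lebesgue_on {s..t}) (\<lambda>x. \<Sum>X\<in>\<X>. k X * indicator X x)"
    by (intro Bochner_Integration.integrable_cong refl f) simp
  ultimately show ?thesis
    by blast
qed

section \<open>Limits of step functions\<close>

definition L1_step_limit :: "real \<Rightarrow> real \<Rightarrow> (real \<Rightarrow> real) \<Rightarrow> bool" where
  "L1_step_limit s t f \<longleftrightarrow>
     integrable (lebesgue_on {s..t}) f \<and>
     (\<forall>e>0. \<exists>g. step_function s t g \<and> (\<integral>x. \<bar>f x - g x\<bar> \<partial>lebesgue_on {s..t}) < e)"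

lemma L1_step_limit_integrable:
  "L1_step_limit s t f \<Longrightarrow> integrable (lebesgue_on {s..t}) f"
  by (simp add: L1_step_limit_def)

lemma L1_step_limit_closed:
  assumes "integrable (lebesgue_on {s..t}) f"
    and "\<And>e. e > 0 \<Longrightarrow> \<exists>g. L1_step_limit s t g \<and> (\<integral>x. \<bar>f x - g x\<bar> \<partial>lebesgue_on {s..t}) < e"
  shows "L1_step_limit s t f"
  unfolding L1_step_limit_def
proof (intro conjI allI impI)
  fix e :: real assume "e > 0"
  then obtain g where g: "L1_step_limit s t g" "(\<integral>x. \<bar>f x - g x\<bar> \<partial>lebesgue_on {s..t}) < e / 2"
    using assms(2)[of "e / 2"] by auto
  then obtain h where h: "step_function s t h" "(\<integral>x. \<bar>g x - h x\<bar> \<partial>lebesgue_on {s..t}) < e / 2"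
    using \<open>e > 0\<close> unfolding L1_step_limit_def by (meson half_gt_zero)
  then show "\<exists>g. step_function s t g \<and> (\<integral>x. \<bar>f x - g x\<bar> \<partial>lebesgue_on {s..t}) < e"
    using integral_abs_triangle[OF assms(1) L1_step_limit_integrable[OF g(1)]
        integrable_step_function[OF h(1)]] g(2)
    by (intro exI[of _ h]) simp
qed (rule assms(1))

lemma L1_step_limit_step:
  "step_function s t f \<Longrightarrow> L1_step_limit s t f"
  using integrable_step_function by (force simp: L1_step_limit_def)

lemma L1_step_limit_cong_AE:
  assumes "L1_step_limit s t f" and "AE x in lebesgue_on {s..t}. f x = g x"
  shows "L1_step_limit s t g"
proof (rule L1_step_limit_closed)
  show g: "integrable (lebesgue_on {s..t}) g"
    using integrable_cong_AE_lebesgue_on(1)[OF L1_step_limit_integrable[OF assms(1)] assms(2)] .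
  have "AE x in lebesgue_on {s..t}. \<bar>g x - f x\<bar> = 0"
    using assms(2) by eventually_elim simp
  then have "(\<integral>x. \<bar>g x - f x\<bar> \<partial>lebesgue_on {s..t}) = 0"
    by (rule integral_eq_zero_AE)
  then show "\<exists>f. L1_step_limit s t f \<and> (\<integral>x. \<bar>g x - f x\<bar> \<partial>lebesgue_on {s..t}) < e" if "e > 0" for e
    using assms(1) that by auto
qed

text \<open>
  All operations on functions needed below preserve limits of step functions for the same reason:
  they preserve step functions and are Lipschitz continuous in the \<open>L\<^sup>1\<close> norm.  Unary
  operations are covered by ignoring the second argument.
\<close>

lemma L1_step_limit_transfer:
  assumes f: "L1_step_limit s t f" and g: "L1_step_limit s t g"
    and step: "\<And>f' g'. step_function s t f' \<Longrightarrow> step_function s t g' \<Longrightarrow> step_function a b (L f' g')"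
    and int: "integrable (lebesgue_on {a..b}) (L f g)"
    and bound: "\<And>f' g'. integrable (lebesgue_on {s..t}) f' \<Longrightarrow> integrable (lebesgue_on {s..t}) g' \<Longrightarrow>
      (\<integral>x. \<bar>L f g x - L f' g' x\<bar> \<partial>lebesgue_on {a..b})
        \<le> C * ((\<integral>x. \<bar>f x - f' x\<bar> \<partial>lebesgue_on {s..t}) + (\<integral>x. \<bar>g x - g' x\<bar> \<partial>lebesgue_on {s..t}))"
  shows "L1_step_limit a b (L f g)"
  unfolding L1_step_limit_def
proof (intro conjI allI impI)
  fix e :: real assume "e > 0"
  \<comment> \<open>Adding \<open>1\<close> makes the divisor \<open>K\<close> positive even if \<open>C\<close> is zero.\<close>
  define K where "K = \<bar>C\<bar> + 1"
  have "K > 0" "\<bar>C\<bar> < K"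
    using abs_ge_zero[of C] by (simp_all add: K_def)
  define \<delta> where "\<delta> = e / (2 * K)"
  have "\<delta> > 0"
    using \<open>e > 0\<close> \<open>K > 0\<close> by (simp add: \<delta>_def)
  then obtain f' g' where f': "step_function s t f'" "(\<integral>x. \<bar>f x - f' x\<bar> \<partial>lebesgue_on {s..t}) < \<delta>"
    and g': "step_function s t g'" "(\<integral>x. \<bar>g x - g' x\<bar> \<partial>lebesgue_on {s..t}) < \<delta>"
    using f g unfolding L1_step_limit_def by meson
  have "(\<integral>x. \<bar>L f g x - L f' g' x\<bar> \<partial>lebesgue_on {a..b})
      \<le> C * ((\<integral>x. \<bar>f x - f' x\<bar> \<partial>lebesgue_on {s..t}) + (\<integral>x. \<bar>g x - g' x\<bar> \<partial>lebesgue_on {s..t}))"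
    using f'(1) g'(1) by (intro bound integrable_step_function)
  also have "\<dots> \<le> \<bar>C\<bar> * (\<delta> + \<delta>)"
    using f'(2) g'(2) by (intro mult_mono) (auto intro!: add_nonneg_nonneg)
  also have "\<dots> < K * (\<delta> + \<delta>)"
    using \<open>\<delta> > 0\<close> \<open>\<bar>C\<bar> < K\<close> by (intro mult_strict_right_mono) simp_all
  also have "\<dots> = e"
    using \<open>K > 0\<close> by (simp add: \<delta>_def)
  finally show "\<exists>h. step_function a b h \<and> (\<integral>x. \<bar>L f g x - h x\<bar> \<partial>lebesgue_on {a..b}) < e"
    using step[OF f'(1) g'(1)] by (intro exI[of _ "L f' g'"] conjI)
qed (rule int)

lemma L1_step_limit_add:
  assumes f: "L1_step_limit s t f" and g: "L1_step_limit s t g"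
  shows "L1_step_limit s t (\<lambda>x. f x + g x)"
proof (rule L1_step_limit_transfer[OF f g, where L = "\<lambda>f g x. f x + g x" and C = 1])
  note [simp] = L1_step_limit_integrable[OF f] L1_step_limit_integrable[OF g]
  show "integrable (lebesgue_on {s..t}) (\<lambda>x. f x + g x)"
    by simp
  fix f' g' :: "real \<Rightarrow> real"
  assume [simp]: "integrable (lebesgue_on {s..t}) f'" "integrable (lebesgue_on {s..t}) g'"
  have "(\<integral>x. \<bar>f x + g x - (f' x + g' x)\<bar> \<partial>lebesgue_on {s..t})
      \<le> (\<integral>x. \<bar>f x - f' x\<bar> + \<bar>g x - g' x\<bar> \<partial>lebesgue_on {s..t})"
    by (intro integral_mono) auto
  then show "(\<integral>x. \<bar>f x + g x - (f' x + g' x)\<bar> \<partial>lebesgue_on {s..t})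
      \<le> 1 * ((\<integral>x. \<bar>f x - f' x\<bar> \<partial>lebesgue_on {s..t}) + (\<integral>x. \<bar>g x - g' x\<bar> \<partial>lebesgue_on {s..t}))"
    by simp
qed (rule step_function_binop)

lemma L1_step_limit_scale:
  assumes f: "L1_step_limit s t f"
  shows "L1_step_limit s t (\<lambda>x. k * f x)"
proof (rule L1_step_limit_transfer[OF f f, where L = "\<lambda>f g x. k * f x" and C = "\<bar>k\<bar>"])
  note [simp] = L1_step_limit_integrable[OF f]
  show "integrable (lebesgue_on {s..t}) (\<lambda>x. k * f x)"
    by simp
  fix f' g' :: "real \<Rightarrow> real"
  have "\<bar>k * f x - k * f' x\<bar> = \<bar>k\<bar> * \<bar>f x - f' x\<bar>" for x
    by (simp add: abs_mult[symmetric] algebra_simps)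
  then show "(\<integral>x. \<bar>k * f x - k * f' x\<bar> \<partial>lebesgue_on {s..t})
      \<le> \<bar>k\<bar> * ((\<integral>x. \<bar>f x - f' x\<bar> \<partial>lebesgue_on {s..t}) + (\<integral>x. \<bar>f x - g' x\<bar> \<partial>lebesgue_on {s..t}))"
    by (simp add: mult_left_mono)
  show "step_function s t (\<lambda>x. k * f' x)" if "step_function s t f'"
    using step_function_binop[OF that that, of "\<lambda>u v. k * u"] .
qed

lemma L1_step_limit_cut:
  assumes f: "L1_step_limit s t f"
  shows "L1_step_limit s t (\<lambda>x. indicator {a..b} x * f x)"
proof (rule L1_step_limit_transfer[OF f f, where L = "\<lambda>f g x. indicator {a..b} x * f x" and C = 1])
  have cut: "integrable (lebesgue_on {s..t}) (\<lambda>x. indicator {a..b} x * h x)"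
    if "integrable (lebesgue_on {s..t}) h" for h :: "real \<Rightarrow> real"
    using integrable_mult_indicator[OF _ that, of "{a..b} \<inter> {s..t}"]
    by (subst Bochner_Integration.integrable_cong[OF refl, where g = "\<lambda>x. indicator ({a..b} \<inter> {s..t}) x *\<^sub>R h x"])
      (auto simp: indicator_def sets_restrict_space_iff)
  note [simp] = L1_step_limit_integrable[OF f]
  show "integrable (lebesgue_on {s..t}) (\<lambda>x. indicator {a..b} x * f x)"
    by (simp add: cut)
  fix f' g' :: "real \<Rightarrow> real"
  assume [simp]: "integrable (lebesgue_on {s..t}) f'"
  have "(\<integral>x. \<bar>indicator {a..b} x * f x - indicator {a..b} x * f' x\<bar> \<partial>lebesgue_on {s..t})
      \<le> (\<integral>x. \<bar>f x - f' x\<bar> \<partial>lebesgue_on {s..t})"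
    by (intro integral_mono integrable_abs Bochner_Integration.integrable_diff cut)
      (auto simp: indicator_def)
  also have "\<dots> \<le> 1 * (\<dots> + (\<integral>x. \<bar>f x - g' x\<bar> \<partial>lebesgue_on {s..t}))"
    by simp
  finally show "(\<integral>x. \<bar>indicator {a..b} x * f x - indicator {a..b} x * f' x\<bar> \<partial>lebesgue_on {s..t})
      \<le> 1 * ((\<integral>x. \<bar>f x - f' x\<bar> \<partial>lebesgue_on {s..t}) + (\<integral>x. \<bar>f x - g' x\<bar> \<partial>lebesgue_on {s..t}))" .
next
  show "step_function s t (\<lambda>x. indicator {a..b} x * h x)" if "step_function s t h" for h
    using step_function_binop[OF step_function_indicator that] .
qed

lemma integrable_subinterval:
  fixes f :: "real \<Rightarrow> real"
  assumes f: "integrable (lebesgue_on {c..d}) f" and sub: "{s..t} \<subseteq> {c..d}"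
  shows "integrable (lebesgue_on {s..t}) f"
proof -
  have "integrable lebesgue (\<lambda>x. indicator {c..d} x *\<^sub>R f x)"
    using f by (simp add: integrable_restrict_space)
  then have "integrable lebesgue (\<lambda>x. indicator {s..t} x *\<^sub>R (indicator {c..d} x *\<^sub>R f x))"
    by (rule integrable_mult_indicator[rotated]) simp
  moreover have "(\<lambda>x. indicator {s..t} x *\<^sub>R (indicator {c..d} x *\<^sub>R f x)) = (\<lambda>x. indicator {s..t} x *\<^sub>R f x)"
    using sub by (auto simp: indicator_def fun_eq_iff)
  ultimately have "integrable lebesgue (\<lambda>x. indicator {s..t} x *\<^sub>R f x)"
    by (simp only:)
  then show ?thesis
    by (simp add: integrable_restrict_space)
qed

lemma integral_subinterval_mono:
  fixes f :: "real \<Rightarrow> real"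
  assumes f: "integrable (lebesgue_on {c..d}) f" and sub: "{s..t} \<subseteq> {c..d}" and "\<And>x. 0 \<le> f x"
  shows "(\<integral>x. f x \<partial>lebesgue_on {s..t}) \<le> (\<integral>x. f x \<partial>lebesgue_on {c..d})"
proof -
  have "(\<integral>x. indicator {s..t} x *\<^sub>R f x \<partial>lebesgue) \<le> (\<integral>x. indicator {c..d} x *\<^sub>R f x \<partial>lebesgue)"
    using f integrable_subinterval[OF f sub] sub assms(3)
    by (intro integral_mono) (auto simp: integrable_restrict_space indicator_def)
  then show ?thesis
    by (simp add: integral_restrict_space)
qed

lemma L1_step_limit_subinterval:
  assumes f: "L1_step_limit c d f" and sub: "{s..t} \<subseteq> {c..d}"
  shows "L1_step_limit s t f"
proof (rule L1_step_limit_transfer[OF f f, where L = "\<lambda>f g. f" and C = 1])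
  note [simp] = L1_step_limit_integrable[OF f]
  show "integrable (lebesgue_on {s..t}) f"
    using integrable_subinterval[OF _ sub] by simp
  fix f' g' :: "real \<Rightarrow> real"
  assume [simp]: "integrable (lebesgue_on {c..d}) f'"
  have "(\<integral>x. \<bar>f x - f' x\<bar> \<partial>lebesgue_on {s..t}) \<le> (\<integral>x. \<bar>f x - f' x\<bar> \<partial>lebesgue_on {c..d})"
    by (rule integral_subinterval_mono[OF _ sub]) simp_all
  also have "\<dots> \<le> 1 * (\<dots> + (\<integral>x. \<bar>f x - g' x\<bar> \<partial>lebesgue_on {c..d}))"
    by simp
  finally show "(\<integral>x. \<bar>f x - f' x\<bar> \<partial>lebesgue_on {s..t})
      \<le> 1 * ((\<integral>x. \<bar>f x - f' x\<bar> \<partial>lebesgue_on {c..d}) + (\<integral>x. \<bar>f x - g' x\<bar> \<partial>lebesgue_on {c..d}))" .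
qed (rule step_function_subinterval[OF _ sub])

text \<open>
  Away from the midpoint the juxtaposition is a sum of two affine substitutions of functions extended
  by zero.  Each substitution has slope \<open>2\<close>, which explains the factor one half.
\<close>

lemma integral_juxtapose:
  fixes f g :: "real \<Rightarrow> real"
  assumes "s \<le> t" and f: "integrable (lebesgue_on {s..t}) f" and g: "integrable (lebesgue_on {s..t}) g"
  shows "integrable (lebesgue_on {s..t}) (juxtapose s t f g)" (is ?int)
    and "(\<integral>x. juxtapose s t f g x \<partial>lebesgue_on {s..t})
      = ((\<integral>x. f x \<partial>lebesgue_on {s..t}) + (\<integral>x. g x \<partial>lebesgue_on {s..t})) / 2" (is ?eq)
proof -
  define ext where "ext h x = indicator {s..t} x *\<^sub>R h x" for h :: "real \<Rightarrow> real" and x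
  have ext: "integrable lebesgue (ext f)" "integrable lebesgue (ext g)"
    using f g by (simp_all add: ext_def[abs_def] integrable_restrict_space)
  have int: "integrable lebesgue (\<lambda>x. ext f (- s + 2 * x))" "integrable lebesgue (\<lambda>x. ext g (- t + 2 * x))"
    by (rule lebesgue_integrable_real_affine[OF ext(1)], simp)
      (rule lebesgue_integrable_real_affine[OF ext(2)], simp)
  have sum_int: "integrable lebesgue (\<lambda>x. ext f (- s + 2 * x) + ext g (- t + 2 * x))"
    using int by simp
  have "AE x in lebesgue. x \<noteq> (s + t) / 2"
    by (rule AE_lebesgue_neq)
  then have AE: "AE x in lebesgue. ext f (- s + 2 * x) + ext g (- t + 2 * x) = ext (juxtapose s t f g) x"
  proof eventually_elim
    case (elim x)
    consider "x < s" | "s \<le> x" "x < (s + t) / 2" | "(s + t) / 2 < x" "x \<le> t" | "t < x"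
      using elim by linarith
    then show ?case
      using \<open>s \<le> t\<close> by cases (auto simp: ext_def juxtapose_def indicator_def field_simps)
  qed
  show ?int
    using integrable_cong_AE_lebesgue(1)[OF sum_int AE]
    by (simp add: ext_def[abs_def] integrable_restrict_space)
  have "(\<integral>x. ext (juxtapose s t f g) x \<partial>lebesgue)
      = (\<integral>x. ext f (- s + 2 * x) \<partial>lebesgue) + (\<integral>x. ext g (- t + 2 * x) \<partial>lebesgue)"
    using integrable_cong_AE_lebesgue(2)[OF sum_int AE] int by simp
  also have "\<dots> = (\<integral>x. ext f x \<partial>lebesgue) / 2 + (\<integral>x. ext g x \<partial>lebesgue) / 2"
    using lebesgue_integral_real_affine[of 2 "ext f" "- s"] lebesgue_integral_real_affine[of 2 "ext g" "- t"]
    by simp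
  finally show ?eq
    by (simp add: ext_def[abs_def] integral_restrict_space add_divide_distrib)
qed

lemma integral_abs_juxtapose_diff:
  assumes "s \<le> t" and "integrable (lebesgue_on {s..t}) f" and "integrable (lebesgue_on {s..t}) g"
    and "integrable (lebesgue_on {s..t}) f'" and "integrable (lebesgue_on {s..t}) g'"
  shows "(\<integral>x. \<bar>juxtapose s t f g x - juxtapose s t f' g' x\<bar> \<partial>lebesgue_on {s..t})
      = ((\<integral>x. \<bar>f x - f' x\<bar> \<partial>lebesgue_on {s..t}) + (\<integral>x. \<bar>g x - g' x\<bar> \<partial>lebesgue_on {s..t})) / 2"
proof -
  have "(\<lambda>x. \<bar>juxtapose s t f g x - juxtapose s t f' g' x\<bar>)
      = juxtapose s t (\<lambda>x. \<bar>f x - f' x\<bar>) (\<lambda>x. \<bar>g x - g' x\<bar>)"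
    by (simp add: juxtapose_def fun_eq_iff)
  then show ?thesis
    using assms integral_juxtapose(2)[of s t "\<lambda>x. \<bar>f x - f' x\<bar>" "\<lambda>x. \<bar>g x - g' x\<bar>"] by simp
qed

lemma L1_step_limit_juxtapose:
  assumes "s \<le> t" and f: "L1_step_limit s t f" and g: "L1_step_limit s t g"
  shows "L1_step_limit s t (juxtapose s t f g)"
proof (rule L1_step_limit_transfer[OF f g, where L = "juxtapose s t" and C = "1 / 2"])
  note int = L1_step_limit_integrable[OF f] L1_step_limit_integrable[OF g]
  show "integrable (lebesgue_on {s..t}) (juxtapose s t f g)"
    using integral_juxtapose(1)[OF \<open>s \<le> t\<close> int] .
qed (use integral_abs_juxtapose_diff[OF \<open>s \<le> t\<close> L1_step_limit_integrable[OF f] L1_step_limit_integrable[OF g]]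
    step_function_juxtapose in simp_all)

text \<open>
  Instead of taking preimages of null sets under the substitutions, one can read this off from the
  \<open>L\<^sup>1\<close> distance of the juxtapositions being zero.
\<close>

lemma juxtapose_cong_AE:
  assumes "s \<le> t" and f: "integrable (lebesgue_on {s..t}) f" and g: "integrable (lebesgue_on {s..t}) g"
    and ff': "AE x in lebesgue_on {s..t}. f x = f' x" and gg': "AE x in lebesgue_on {s..t}. g x = g' x"
  shows "AE x in lebesgue_on {s..t}. juxtapose s t f g x = juxtapose s t f' g' x"
proof -
  have f': "integrable (lebesgue_on {s..t}) f'" and g': "integrable (lebesgue_on {s..t}) g'"
    using integrable_cong_AE_lebesgue_on(1) f ff' g gg' by blast+
  have "AE x in lebesgue_on {s..t}. \<bar>f x - f' x\<bar> = 0" "AE x in lebesgue_on {s..t}. \<bar>g x - g' x\<bar> = 0"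
    using ff' gg' by auto
  then have "(\<integral>x. \<bar>juxtapose s t f g x - juxtapose s t f' g' x\<bar> \<partial>lebesgue_on {s..t}) = 0"
    unfolding integral_abs_juxtapose_diff[OF \<open>s \<le> t\<close> f g f' g'] by (simp add: integral_eq_zero_AE)
  moreover have "integrable (lebesgue_on {s..t}) (\<lambda>x. \<bar>juxtapose s t f g x - juxtapose s t f' g' x\<bar>)"
    using integral_juxtapose(1)[OF \<open>s \<le> t\<close>] f g f' g' by simp
  ultimately have "AE x in lebesgue_on {s..t}. \<bar>juxtapose s t f g x - juxtapose s t f' g' x\<bar> = 0"
    by (subst (asm) integral_nonneg_eq_0_iff_AE) auto
  then show ?thesis
    by eventually_elim simp
qed

section \<open>The space of classes as an object of the category\<close>

lemma rep_ae_class: "AE x in lebesgue_on {s..t}. rep (ae_class s t f) x = f x"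
proof -
  have "f \<in> ae_class s t f"
    by (simp add: ae_class_def)
  then have "rep (ae_class s t f) \<in> ae_class s t f"
    unfolding rep_def by (rule someI[of "\<lambda>g. g \<in> ae_class s t f"])
  then show ?thesis
    by (simp add: ae_class_def)
qed

lemma ae_class_eqI:
  assumes "AE x in lebesgue_on {s..t}. f x = g x"
  shows "ae_class s t f = ae_class s t g"
proof -
  have "(AE x in lebesgue_on {s..t}. h x = f x) \<longleftrightarrow> (AE x in lebesgue_on {s..t}. h x = g x)" for h
    using assms by (intro iffI; elim eventually_elim2) auto
  then show ?thesis
    by (simp add: ae_class_def)
qed

lemma ae_class_eqD:
  assumes "ae_class s t f = ae_class s t g"
  shows "AE x in lebesgue_on {s..t}. f x = g x"
proof -
  have "f \<in> ae_class s t f"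
    by (simp add: ae_class_def)
  then show ?thesis
    unfolding assms by (simp add: ae_class_def)
qed

text \<open>
  The operations on classes are defined through chosen representatives.  This lemma and its
  companions below replace these by arbitrary representatives, after which the laws of a vector space
  are pointwise identities.
\<close>

lemma cl_add_ae_class:
  "cl_add s t (ae_class s t f) (ae_class s t g) = ae_class s t (\<lambda>x. f x + g x)"
  unfolding cl_add_def by (rule ae_class_eqI) (use rep_ae_class[of s t f] rep_ae_class[of s t g] in auto)

lemma cl_scale_ae_class:
  "cl_scale s t k (ae_class s t f) = ae_class s t (\<lambda>x. k * f x)"
  unfolding cl_scale_def by (rule ae_class_eqI) (use rep_ae_class[of s t f] in auto)

lemma cl_cut_ae_class:
  "cl_cut s t A (ae_class s t f) = ae_class s t (\<lambda>x. indicator A x * f x)"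
  unfolding cl_cut_def by (rule ae_class_eqI) (use rep_ae_class[of s t f] in auto)

lemma cl_restrict_ae_class:
  assumes "{s..t} \<subseteq> {c..d}"
  shows "cl_restrict s t (ae_class c d f) = ae_class s t f"
  unfolding cl_restrict_def
proof (rule ae_class_eqI)
  have "AE x in lebesgue. x \<in> {c..d} \<longrightarrow> rep (ae_class c d f) x = f x"
    using rep_ae_class[where s = c and t = d] by (simp add: AE_restrict_space_iff)
  then have "AE x in lebesgue. x \<in> {s..t} \<longrightarrow> rep (ae_class c d f) x = f x"
    by eventually_elim (use assms in blast)
  then show "AE x in lebesgue_on {s..t}. rep (ae_class c d f) x = f x"
    by (simp add: AE_restrict_space_iff)
qed

lemma integral_rep_ae_class:
  assumes "integrable (lebesgue_on {s..t}) f"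
  shows "(\<integral>x. rep (ae_class s t f) x \<partial>lebesgue_on {s..t}) = (\<integral>x. f x \<partial>lebesgue_on {s..t})"
    and "(\<integral>x. \<bar>rep (ae_class s t f) x\<bar> \<partial>lebesgue_on {s..t}) = (\<integral>x. \<bar>f x\<bar> \<partial>lebesgue_on {s..t})"
proof -
  have f: "AE x in lebesgue_on {s..t}. f x = rep (ae_class s t f) x"
    using rep_ae_class[of s t f] by (simp add: eq_commute)
  then have abs_f: "AE x in lebesgue_on {s..t}. \<bar>f x\<bar> = \<bar>rep (ae_class s t f) x\<bar>"
    by eventually_elim simp
  show "(\<integral>x. rep (ae_class s t f) x \<partial>lebesgue_on {s..t}) = (\<integral>x. f x \<partial>lebesgue_on {s..t})"
    and "(\<integral>x. \<bar>rep (ae_class s t f) x\<bar> \<partial>lebesgue_on {s..t}) = (\<integral>x. \<bar>f x\<bar> \<partial>lebesgue_on {s..t})"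
    using integrable_cong_AE_lebesgue_on(2)[OF assms f]
      integrable_cong_AE_lebesgue_on(2)[OF integrable_abs[OF assms] abs_f]
    by blast+
qed

lemma Shat_eq: "Shat s t = ae_class s t ` {f. L1_step_limit s t f}"
  unfolding Shat_def L1_step_limit_def by blast

lemma ae_class_in_Shat: "L1_step_limit s t f \<Longrightarrow> ae_class s t f \<in> Shat s t"
  by (simp add: Shat_eq)

lemma Shat_cases:
  assumes "F \<in> Shat s t"
  obtains f where "L1_step_limit s t f" and "F = ae_class s t f"
  using assms by (auto simp: Shat_eq)

lemma Shat_obj_simps [simp]:
  "ncarrier (Shat_obj s t) = Shat s t"
  "nadd (Shat_obj s t) = cl_add s t"
  "nscale (Shat_obj s t) = cl_scale s t"
  "nzero (Shat_obj s t) = ae_class s t (\<lambda>x. 0)"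
  "nnorm (Shat_obj s t) = (\<lambda>F. \<integral>x. \<bar>rep F x\<bar> \<partial>lebesgue_on {s..t})"
  "npoint (Shat_obj s t) = ae_class s t (indicator {s..t})"
  by (simp_all add: Shat_obj_def)

lemma nglue_Shat_ae_class:
  assumes "s \<le> t" and "L1_step_limit s t f" and "L1_step_limit s t g"
  shows "nglue (Shat_obj s t) (ae_class s t f) (ae_class s t g) = ae_class s t (juxtapose s t f g)"
proof -
  note f = L1_step_limit_integrable[OF assms(2)] and g = L1_step_limit_integrable[OF assms(3)]
  have "AE x in lebesgue_on {s..t}. juxtapose s t f g x
      = juxtapose s t (rep (ae_class s t f)) (rep (ae_class s t g)) x"
    using rep_ae_class[of s t f] rep_ae_class[of s t g]
    by (intro juxtapose_cong_AE[OF \<open>s \<le> t\<close> f g]) (simp_all add: eq_commute)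
  then show ?thesis
    by (simp add: Shat_obj_def ae_class_eqI)
qed

lemma juxtapose_add:
  "juxtapose s t (\<lambda>x. f x + f' x) (\<lambda>x. g x + g' x)
    = (\<lambda>x. juxtapose s t f g x + juxtapose s t f' g' x)"
  by (simp add: juxtapose_def fun_eq_iff)

lemma juxtapose_scale:
  "juxtapose s t (\<lambda>x. k * f x) (\<lambda>x. k * g x) = (\<lambda>x. k * juxtapose s t f g x)"
  by (simp add: juxtapose_def fun_eq_iff)

lemma real_obj_simps [simp]:
  "ncarrier (real_obj s t) = UNIV"
  "nadd (real_obj s t) = (+)"
  "nscale (real_obj s t) = (*)"
  "nzero (real_obj s t) = 0"
  "nnorm (real_obj s t) = abs"
  "npoint (real_obj s t) = t - s"
  "nglue (real_obj s t) = (\<lambda>x y. (x + y) / 2)"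
  by (simp_all add: real_obj_def)

lemma L1_step_limit_zero: "L1_step_limit s t (\<lambda>x. 0)"
  by (rule L1_step_limit_step) (auto simp: step_function_iff_same_cell)

lemma real_vector_space_Shat: "real_vector_space_rec (Shat_obj s t)"
proof -
  have closed: "cl_add s t F G \<in> Shat s t" "cl_scale s t k F \<in> Shat s t"
    if "F \<in> Shat s t" "G \<in> Shat s t" for F G k
    using that by (auto elim!: Shat_cases simp: cl_add_ae_class cl_scale_ae_class
        intro!: ae_class_in_Shat L1_step_limit_add L1_step_limit_scale)
  have assoc: "cl_add s t (cl_add s t F G) H = cl_add s t F (cl_add s t G H)"
    if "F \<in> Shat s t" "G \<in> Shat s t" "H \<in> Shat s t" for F G H
    using that by (auto elim!: Shat_cases simp: cl_add_ae_class add.assoc)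
  have comm: "cl_add s t F G = cl_add s t G F"
    if "F \<in> Shat s t" "G \<in> Shat s t" for F G
    using that by (auto elim!: Shat_cases simp: cl_add_ae_class add.commute)
  have zero: "cl_add s t (ae_class s t (\<lambda>x. 0)) F = F" "cl_scale s t 1 F = F"
    if "F \<in> Shat s t" for F
    using that by (auto elim!: Shat_cases simp: cl_add_ae_class cl_scale_ae_class)
  have inv: "\<exists>G\<in>Shat s t. cl_add s t F G = ae_class s t (\<lambda>x. 0)"
    if F: "F \<in> Shat s t" for F
  proof (rule bexI)
    show "cl_add s t F (cl_scale s t (- 1) F) = ae_class s t (\<lambda>x. 0)"
      using F by (auto elim!: Shat_cases simp: cl_add_ae_class cl_scale_ae_class)
  qed (rule closed(2)[OF F F])
  have distrib: "cl_scale s t k (cl_add s t F G) = cl_add s t (cl_scale s t k F) (cl_scale s t k G)"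
    if "F \<in> Shat s t" "G \<in> Shat s t" for F G k
    using that by (auto elim!: Shat_cases simp: cl_add_ae_class cl_scale_ae_class distrib_left)
  have scale: "cl_scale s t (k + l) F = cl_add s t (cl_scale s t k F) (cl_scale s t l F)"
    "cl_scale s t k (cl_scale s t l F) = cl_scale s t (k * l) F"
    if "F \<in> Shat s t" for F k l
    using that by (auto elim!: Shat_cases simp: cl_add_ae_class cl_scale_ae_class distrib_right mult.assoc)
  show ?thesis
    unfolding real_vector_space_rec_def Shat_obj_simps
    by (intro conjI ballI allI ae_class_in_Shat L1_step_limit_zero closed assoc comm zero inv distrib scale)
qed

lemma real_normed_space_Shat: "real_normed_space_rec (Shat_obj s t)"
proof -
  have zero: "(\<integral>x. \<bar>rep F x\<bar> \<partial>lebesgue_on {s..t}) = 0 \<longleftrightarrow> F = ae_class s t (\<lambda>x. 0)"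
    if F: "F \<in> Shat s t" for F
  proof -
    obtain f where f: "L1_step_limit s t f" "F = ae_class s t f"
      using F by (rule Shat_cases)
    note int = L1_step_limit_integrable[OF f(1)]
    have "(\<integral>x. \<bar>rep F x\<bar> \<partial>lebesgue_on {s..t}) = 0 \<longleftrightarrow> (AE x in lebesgue_on {s..t}. \<bar>f x\<bar> = 0)"
      unfolding f(2) integral_rep_ae_class(2)[OF int]
      using int by (intro integral_nonneg_eq_0_iff_AE) auto
    also have "\<dots> \<longleftrightarrow> F = ae_class s t (\<lambda>x. 0)"
      unfolding f(2) using ae_class_eqI[of f "\<lambda>x. 0" s t] ae_class_eqD[of s t f "\<lambda>x. 0"] by auto
    finally show ?thesis .
  qed
  have scale: "(\<integral>x. \<bar>rep (cl_scale s t k F) x\<bar> \<partial>lebesgue_on {s..t})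
      = \<bar>k\<bar> * (\<integral>x. \<bar>rep F x\<bar> \<partial>lebesgue_on {s..t})"
    if F: "F \<in> Shat s t" for F k
  proof -
    obtain f where f: "L1_step_limit s t f" "F = ae_class s t f"
      using F by (rule Shat_cases)
    show ?thesis
      using L1_step_limit_integrable[OF f(1)]
      by (simp add: f(2) cl_scale_ae_class integral_rep_ae_class(2) abs_mult)
  qed
  have triangle: "(\<integral>x. \<bar>rep (cl_add s t F G) x\<bar> \<partial>lebesgue_on {s..t})
      \<le> (\<integral>x. \<bar>rep F x\<bar> \<partial>lebesgue_on {s..t}) + (\<integral>x. \<bar>rep G x\<bar> \<partial>lebesgue_on {s..t})"
    if F: "F \<in> Shat s t" and G: "G \<in> Shat s t" for F G
  proof -
    obtain f where f: "L1_step_limit s t f" "F = ae_class s t f"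
      using F by (rule Shat_cases)
    obtain g where g: "L1_step_limit s t g" "G = ae_class s t g"
      using G by (rule Shat_cases)
    note [simp] = L1_step_limit_integrable[OF f(1)] L1_step_limit_integrable[OF g(1)]
    have "(\<integral>x. \<bar>f x + g x\<bar> \<partial>lebesgue_on {s..t}) \<le> (\<integral>x. \<bar>f x\<bar> + \<bar>g x\<bar> \<partial>lebesgue_on {s..t})"
      by (intro integral_mono) auto
    then show ?thesis
      by (simp add: f(2) g(2) cl_add_ae_class integral_rep_ae_class(2))
  qed
  show ?thesis
    unfolding real_normed_space_rec_def
    using real_vector_space_Shat zero scale triangle by simp
qed

text \<open>
  An \<open>L\<^sup>1\<close> limit exists by Riesz--Fischer; it is again a limit of step functions,
  being approximated by the members of the sequence.
\<close>

lemma real_banach_space_Shat: "real_banach_space_rec (Shat_obj s t)"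
  unfolding real_banach_space_rec_def
proof (intro conjI allI impI real_normed_space_Shat)
  fix \<sigma> :: "nat \<Rightarrow> (real \<Rightarrow> real) set"
  assume \<sigma>: "(\<forall>n. \<sigma> n \<in> ncarrier (Shat_obj s t)) \<and>
    (\<forall>e>0. \<exists>M. \<forall>m\<ge>M. \<forall>n\<ge>M. ndist (Shat_obj s t) (\<sigma> m) (\<sigma> n) < e)"
  then have "\<forall>n. \<exists>f. L1_step_limit s t f \<and> \<sigma> n = ae_class s t f"
    by (metis Shat_cases Shat_obj_simps(1))
  then obtain u where u: "\<And>n. L1_step_limit s t (u n)" "\<And>n. \<sigma> n = ae_class s t (u n)"
    by metis
  have dist: "ndist (Shat_obj s t) (ae_class s t f) (ae_class s t g)
      = (\<integral>x. \<bar>f x - g x\<bar> \<partial>lebesgue_on {s..t})"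
    if "integrable (lebesgue_on {s..t}) f" "integrable (lebesgue_on {s..t}) g" for f g
    using that by (simp add: ndist_def cl_scale_ae_class cl_add_ae_class integral_rep_ae_class(2))
  note int = L1_step_limit_integrable[OF u(1)]
  have "\<exists>N. \<forall>m\<ge>N. \<forall>n\<ge>N. (\<integral>x. \<bar>u m x - u n x\<bar> \<partial>lebesgue_on {s..t}) < e" if "e > 0" for e
    using \<sigma> that by (simp add: u(2) dist[OF int int])
  from L1_complete[OF int this] obtain f where f: "integrable (lebesgue_on {s..t}) f"
    and lim: "(\<lambda>n. \<integral>x. \<bar>u n x - f x\<bar> \<partial>lebesgue_on {s..t}) \<longlonglongrightarrow> 0"
    by blast
  have "L1_step_limit s t f"
  proof (rule L1_step_limit_closed[OF f])
    fix e :: real assume "e > 0"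
    then have "\<forall>\<^sub>F n in sequentially. (\<integral>x. \<bar>u n x - f x\<bar> \<partial>lebesgue_on {s..t}) < e"
      using lim by (rule order_tendstoD(2)[rotated])
    then obtain n where "(\<integral>x. \<bar>u n x - f x\<bar> \<partial>lebesgue_on {s..t}) < e"
      by (auto simp: eventually_sequentially)
    then show "\<exists>g. L1_step_limit s t g \<and> (\<integral>x. \<bar>f x - g x\<bar> \<partial>lebesgue_on {s..t}) < e"
      using u(1) by (intro exI[of _ "u n"]) (simp add: abs_minus_commute)
  qed
  then have "ae_class s t f \<in> ncarrier (Shat_obj s t)"
    by (simp add: ae_class_in_Shat)
  moreover have "(\<lambda>n. ndist (Shat_obj s t) (\<sigma> n) (ae_class s t f)) \<longlonglongrightarrow> 0"
    using lim by (simp add: u(2) dist[OF int f])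
  ultimately show "\<exists>x\<in>ncarrier (Shat_obj s t). (\<lambda>n. ndist (Shat_obj s t) (\<sigma> n) x) \<longlonglongrightarrow> 0"
    by blast
qed

lemma L1_step_limit_indicator: "L1_step_limit s t (indicator {a..b})"
  by (intro L1_step_limit_step step_function_indicator)

lemma integral_indicator_Icc:
  fixes a b s t :: real
  assumes "a \<le> b" and "{a..b} \<subseteq> {s..t}"
  shows "(\<integral>x. indicat_real {a..b} x \<partial>lebesgue_on {s..t}) = b - a"
proof -
  have "{a..b} \<inter> {s..t} = {a..b}"
    using assms(2) by blast
  moreover have "measure (lebesgue_on {s..t}) {a..b} = measure lebesgue {a..b}"
    using assms(2) by (intro measure_restrict_space) simp_all
  ultimately show ?thesis
    using assms(1) by simp
qed

lemma A1_obj_Shat: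
  assumes "s \<le> t"
  shows "A1_obj s t (Shat_obj s t)"
proof -
  note glue = nglue_Shat_ae_class[OF assms]
  note jux = L1_step_limit_juxtapose[OF assms]
  have closed: "nglue (Shat_obj s t) F G \<in> Shat s t" if "F \<in> Shat s t" "G \<in> Shat s t" for F G
    using that by (auto elim!: Shat_cases simp: glue intro!: ae_class_in_Shat jux)
  have add: "nglue (Shat_obj s t) (cl_add s t F F') (cl_add s t G G')
      = cl_add s t (nglue (Shat_obj s t) F G) (nglue (Shat_obj s t) F' G')"
    if "F \<in> Shat s t" "G \<in> Shat s t" "F' \<in> Shat s t" "G' \<in> Shat s t" for F G F' G'
    using that by (auto elim!: Shat_cases simp: glue cl_add_ae_class L1_step_limit_add
        juxtapose_add)
  have scale: "nglue (Shat_obj s t) (cl_scale s t k F) (cl_scale s t k G)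
      = cl_scale s t k (nglue (Shat_obj s t) F G)"
    if "F \<in> Shat s t" "G \<in> Shat s t" for F G k
    using that by (auto elim!: Shat_cases simp: glue cl_scale_ae_class L1_step_limit_scale
        juxtapose_scale)
  have norm: "nnorm (Shat_obj s t) (nglue (Shat_obj s t) F G)
      \<le> (nnorm (Shat_obj s t) F + nnorm (Shat_obj s t) G) / 2"
    if F: "F \<in> Shat s t" and G: "G \<in> Shat s t" for F G
  proof -
    obtain f where f: "L1_step_limit s t f" "F = ae_class s t f"
      using F by (rule Shat_cases)
    obtain g where g: "L1_step_limit s t g" "G = ae_class s t g"
      using G by (rule Shat_cases)
    note int = L1_step_limit_integrable[OF f(1)] L1_step_limit_integrable[OF g(1)]
    have "(\<integral>x. \<bar>juxtapose s t f g x\<bar> \<partial>lebesgue_on {s..t})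
        = ((\<integral>x. \<bar>f x\<bar> \<partial>lebesgue_on {s..t}) + (\<integral>x. \<bar>g x\<bar> \<partial>lebesgue_on {s..t})) / 2"
      using integral_abs_juxtapose_diff[OF assms int, of "\<lambda>x. 0" "\<lambda>x. 0"]
      by (simp add: juxtapose_def)
    then show ?thesis
      using integral_juxtapose(1)[OF assms int]
      by (simp add: f(2) g(2) glue[OF f(1) g(1)] integral_rep_ae_class(2) int)
  qed
  have "ae_class s t (juxtapose s t (indicator {s..t}) (indicator {s..t})) = ae_class s t (indicator {s..t})"
  proof (rule ae_class_eqI)
    have "juxtapose s t (indicator {s..t}) (indicator {s..t}) x = indicator {s..t} x" if "x \<in> {s..t}" for x
      using that by (auto simp: juxtapose_def indicator_def)
    then show "AE x in lebesgue_on {s..t}.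
        juxtapose s t (indicator {s..t}) (indicator {s..t}) x = indicator {s..t} x"
      by (intro AE_I2) simp
  qed
  then have point: "nglue (Shat_obj s t) (npoint (Shat_obj s t)) (npoint (Shat_obj s t)) = npoint (Shat_obj s t)"
    by (simp add: glue L1_step_limit_indicator)
  have "nnorm (Shat_obj s t) (npoint (Shat_obj s t)) = t - s"
    using assms integral_indicator_Icc[of s t s t] L1_step_limit_integrable[OF L1_step_limit_indicator]
    by (simp add: integral_rep_ae_class(2))
  then show ?thesis
    unfolding A1_obj_def
    using real_banach_space_Shat closed add scale norm point ae_class_in_Shat[OF L1_step_limit_indicator]
    by simp
qed

lemma A1_obj_real:
  assumes "s \<le> t"
  shows "A1_obj s t (real_obj s t)"
proof -
  have "\<exists>x. (\<lambda>n. \<bar>\<sigma> n - x\<bar>) \<longlonglongrightarrow> 0"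
    if "\<forall>e>0. \<exists>M. \<forall>m\<ge>M. \<forall>n\<ge>M. \<bar>\<sigma> m - \<sigma> n\<bar> < e" for \<sigma> :: "nat \<Rightarrow> real"
  proof -
    have "Cauchy \<sigma>"
      using that by (simp add: Cauchy_def dist_real_def)
    then obtain x where "\<sigma> \<longlonglongrightarrow> x"
      using Cauchy_convergent convergent_def by blast
    then show ?thesis
      by (auto simp: tendsto_rabs_zero_iff LIM_zero_iff)
  qed
  moreover have "\<exists>y. x + y = 0" for x :: real
    by (rule exI[of _ "- x"]) simp
  moreover have "\<bar>(x + y) / 2\<bar> \<le> (\<bar>x\<bar> + \<bar>y\<bar>) / 2" for x y :: real
    by simp
  ultimately show ?thesis
    using assms
    by (simp add: A1_obj_def real_banach_space_rec_def real_normed_space_rec_def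
        real_vector_space_rec_def ndist_def abs_mult algebra_simps add_divide_distrib abs_triangle_ineq)
qed

section \<open>Integration is the only morphism to the reals\<close>

lemma AE_lebesgue_on_neq: "AE x in lebesgue_on {s..t}. x \<noteq> (a::real)"
proof -
  have "AE x in lebesgue. x \<in> {s..t} \<longrightarrow> x \<noteq> a"
    using AE_lebesgue_neq[of a] by eventually_elim simp
  then show ?thesis
    by (simp add: AE_restrict_space_iff)
qed

text \<open>
  Up to its two end points an interval is a difference of two intervals that start at \<open>s\<close>.
  This reduces the indicators of all intervals to those of the form \<open>{s..x}\<close>.
\<close>

lemma interval_eq_Icc_diff_AE:
  fixes X :: "real set"
  assumes "is_interval X" and "X \<noteq> {}" and "X \<subseteq> {s..t}"
  shows "AE x in lebesgue_on {s..t}.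
    indicat_real {s..Sup X} x + - 1 * indicat_real {s..Inf X} x = indicator X x"
proof -
  have bdd: "bdd_above X" "bdd_below X"
    using assms(3) by (auto intro: bdd_above_mono bdd_below_mono)
  have "AE x in lebesgue_on {s..t}. x \<in> {s..t}"
    by (rule AE_I2) simp
  with AE_lebesgue_on_neq[of "Inf X"] AE_lebesgue_on_neq[of "Sup X"] show ?thesis
  proof eventually_elim
    case (elim x)
    have "Inf X \<le> Sup X"
      using assms(2) bdd by (rule cInf_le_cSup)
    moreover have "x \<in> X" if x: "Inf X < x" "x < Sup X"
    proof -
      obtain z w where "z \<in> X" "z < x" "w \<in> X" "x < w"
        using cInf_lessD[OF assms(2) x(1)] less_cSupD[OF assms(2) x(2)] by blast
      then show ?thesis
        using assms(1) by (meson is_interval_1 less_imp_le)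
    qed
    moreover have "Inf X \<le> x" "x \<le> Sup X" if "x \<in> X"
      using that bdd by (auto intro: cInf_lower cSup_upper)
    ultimately show ?case
      using elim by (cases "x < Inf X"; cases "Sup X < x"; cases "x \<in> X") (auto simp: indicator_def)
  qed
qed

text \<open>
  The difference \<open>\<Phi>\<close> from the integral is shown to vanish on the indicators of
  \<open>{s..x}\<close> by a self-similarity argument, and then on everything by linearity and
  continuity.
\<close>

lemma A1_hom_Shat_eq_integral:
  assumes "s \<le> t" and \<theta>: "\<theta> \<in> A1_hom s t (Shat_obj s t) (real_obj s t)" and f: "L1_step_limit s t f"
  shows "\<theta> (ae_class s t f) = (\<integral>x. f x \<partial>lebesgue_on {s..t})"
proof -
  define \<Phi> where "\<Phi> g = \<theta> (ae_class s t g) - (\<integral>x. g x \<partial>lebesgue_on {s..t})" for g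
  note int = L1_step_limit_integrable and cls = ae_class_in_Shat
  have "\<exists>B. \<forall>F\<in>Shat s t. \<bar>\<theta> F\<bar> \<le> B * (\<integral>x. \<bar>rep F x\<bar> \<partial>lebesgue_on {s..t})"
    and point: "\<theta> (ae_class s t (indicator {s..t})) = t - s"
    and \<theta>_add: "\<forall>F\<in>Shat s t. \<forall>G\<in>Shat s t. \<theta> (cl_add s t F G) = \<theta> F + \<theta> G"
    and \<theta>_scale: "\<forall>k. \<forall>F\<in>Shat s t. \<theta> (cl_scale s t k F) = k * \<theta> F"
    and \<theta>_glue: "\<forall>F\<in>Shat s t. \<forall>G\<in>Shat s t.
        \<theta> (nglue (Shat_obj s t) F G) = (\<theta> F + \<theta> G) / 2"
    using \<theta> unfolding A1_hom_def by simp_all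
  then obtain B where B: "\<forall>F\<in>Shat s t. \<bar>\<theta> F\<bar> \<le> B * (\<integral>x. \<bar>rep F x\<bar> \<partial>lebesgue_on {s..t})"
    by blast
  define C where "C = \<bar>B\<bar> + 1"
  have "C > 0"
    using abs_ge_zero[of B] by (simp add: C_def)
  have bound: "\<bar>\<Phi> g\<bar> \<le> C * (\<integral>x. \<bar>g x\<bar> \<partial>lebesgue_on {s..t})" if g: "L1_step_limit s t g" for g
  proof -
    have "\<bar>\<theta> (ae_class s t g)\<bar> \<le> B * (\<integral>x. \<bar>g x\<bar> \<partial>lebesgue_on {s..t})"
      using B[rule_format, OF cls[OF g]] by (simp add: integral_rep_ae_class(2)[OF int[OF g]])
    also have "\<dots> \<le> \<bar>B\<bar> * (\<integral>x. \<bar>g x\<bar> \<partial>lebesgue_on {s..t})"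
      by (intro mult_right_mono) simp_all
    finally show ?thesis
      using integral_abs_bound[of "lebesgue_on {s..t}" g]
        abs_triangle_ineq4[of "\<theta> (ae_class s t g)" "\<integral>x. g x \<partial>lebesgue_on {s..t}"]
      unfolding \<Phi>_def C_def distrib_right by linarith
  qed
  have add: "\<Phi> (\<lambda>x. g x + h x) = \<Phi> g + \<Phi> h" if "L1_step_limit s t g" "L1_step_limit s t h" for g h
    using \<theta>_add[rule_format, OF cls cls, OF that] int[OF that(1)] int[OF that(2)] by (simp add: \<Phi>_def cl_add_ae_class)
  have scale: "\<Phi> (\<lambda>x. k * g x) = k * \<Phi> g" if "L1_step_limit s t g" for g k
    using \<theta>_scale[rule_format, OF cls, OF that] by (simp add: \<Phi>_def cl_scale_ae_class right_diff_distrib)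
  have juxt: "\<Phi> (juxtapose s t g h) = (\<Phi> g + \<Phi> h) / 2"
    if "L1_step_limit s t g" "L1_step_limit s t h" for g h
    using \<theta>_glue[rule_format, OF cls cls, OF that]
      integral_juxtapose(2)[OF \<open>s \<le> t\<close> int[OF that(1)] int[OF that(2)]]
    by (simp add: \<Phi>_def nglue_Shat_ae_class[OF \<open>s \<le> t\<close> that] add_divide_distrib diff_divide_distrib)
  have cong: "\<Phi> g = \<Phi> h" if "L1_step_limit s t g" "AE x in lebesgue_on {s..t}. g x = h x" for g h
    using ae_class_eqI[OF that(2)] integrable_cong_AE_lebesgue_on(2)[OF int[OF that(1)] that(2)]
    by (simp add: \<Phi>_def)
  have zero: "\<Phi> (\<lambda>x. 0) = 0"
    using bound[OF L1_step_limit_zero] by simp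
  have whole: "\<Phi> (indicator {s..t}) = 0"
    using point integral_indicator_Icc[of s t s t] \<open>s \<le> t\<close> by (simp add: \<Phi>_def)
  note ind = L1_step_limit_indicator
  define h where "h x = \<Phi> (indicator {s..x})" for x
  \<comment> \<open>Iterating the self-similarity gains a factor one half each time; the initial bound is that of \<open>\<Phi>\<close>.\<close>
  have h_bound: "\<bar>h x\<bar> \<le> C * (t - s) * (1 / 2) ^ n" if "x \<in> {s..t}" for x n
    using that
  proof (induction n arbitrary: x)
    case 0
    have "\<bar>h x\<bar> \<le> C * (\<integral>y. \<bar>indicat_real {s..x} y\<bar> \<partial>lebesgue_on {s..t})"
      unfolding h_def by (rule bound[OF ind])
    also have "(\<integral>y. \<bar>indicat_real {s..x} y\<bar> \<partial>lebesgue_on {s..t}) = x - s"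
      using 0 integral_indicator_Icc[of s x s t] by simp
    finally show ?case
      using 0 \<open>C > 0\<close> by (simp add: order_trans[OF _ mult_left_mono])
  next
    case (Suc n)
    have halve: "C * (t - s) * (1 / 2) ^ Suc n = C * (t - s) * (1 / 2) ^ n / 2"
      by simp
    show ?case
    proof (cases "x < (s + t) / 2")
      case True
      have "h x = \<Phi> (juxtapose s t (indicator {s..2 * x - s}) (\<lambda>x. 0))"
        unfolding h_def
        by (intro cong[OF ind] AE_I2) (use True in \<open>auto simp: juxtapose_def indicator_def\<close>)
      also have "\<dots> = h (2 * x - s) / 2"
        by (simp add: juxt[OF ind L1_step_limit_zero] zero h_def)
      finally have "\<bar>h x\<bar> = \<bar>h (2 * x - s)\<bar> / 2"
        by simp
      moreover have "\<bar>h (2 * x - s)\<bar> \<le> C * (t - s) * (1 / 2) ^ n"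
        using Suc.prems True by (intro Suc.IH) (simp add: field_simps)
      ultimately show ?thesis
        unfolding halve by linarith
    next
      case False
      have "h x = \<Phi> (juxtapose s t (indicator {s..t}) (indicator {s..2 * x - t}))"
        unfolding h_def
        by (intro cong[OF ind] AE_I2) (use False in \<open>auto simp: juxtapose_def indicator_def\<close>)
      also have "\<dots> = h (2 * x - t) / 2"
        by (simp add: juxt[OF ind ind] whole h_def)
      finally have "\<bar>h x\<bar> = \<bar>h (2 * x - t)\<bar> / 2"
        by simp
      moreover have "\<bar>h (2 * x - t)\<bar> \<le> C * (t - s) * (1 / 2) ^ n"
        using Suc.prems False by (intro Suc.IH) (simp add: field_simps)
      ultimately show ?thesis
        unfolding halve by linarith
    qed
  qed
  have h_zero: "h x = 0" if "x \<in> {s..t}" for x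
  proof -
    have "(\<lambda>n. C * (t - s) * (1 / 2) ^ n) \<longlonglongrightarrow> C * (t - s) * 0"
      by (intro tendsto_intros) simp_all
    then have "\<bar>h x\<bar> \<le> C * (t - s) * 0"
      by (rule LIMSEQ_le_const) (use h_bound[OF that] in blast)
    then show ?thesis
      by simp
  qed
  have interval: "L1_step_limit s t (indicator X) \<and> \<Phi> (indicator X) = 0"
    if X: "is_interval X" "X \<subseteq> {s..t}" for X
  proof (cases "X = {}")
    case True
    then have "indicat_real X = (\<lambda>x. 0)"
      by (simp add: indicator_def fun_eq_iff)
    then show ?thesis
      using zero L1_step_limit_zero by simp
  next
    case False
    note AE = interval_eq_Icc_diff_AE[OF X(1) False X(2)]
    have lim: "L1_step_limit s t (\<lambda>x. indicat_real {s..Sup X} x + - 1 * indicat_real {s..Inf X} x)"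
      by (intro L1_step_limit_add L1_step_limit_scale ind)
    have "\<Phi> (\<lambda>x. indicat_real {s..Sup X} x + - 1 * indicat_real {s..Inf X} x) = h (Sup X) - h (Inf X)"
      unfolding h_def by (subst add[OF ind L1_step_limit_scale[OF ind]], subst scale[OF ind]) simp
    moreover have "Sup X \<in> {s..t}" "Inf X \<in> {s..t}"
    proof -
      obtain x where x: "x \<in> X"
        using False by blast
      have "bdd_above X" "bdd_below X"
        using X(2) by (auto intro: bdd_above_mono bdd_below_mono)
      then have "s \<le> Sup X" "Inf X \<le> t"
        using x X(2) by (auto intro!: cSup_upper2[of x] cInf_lower2[of x])
      moreover have "Sup X \<le> t" "s \<le> Inf X"
        using X(2) False by (auto intro!: cSup_least cInf_greatest)
      ultimately show "Sup X \<in> {s..t}" "Inf X \<in> {s..t}"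
        using cInf_le_cSup[OF False \<open>bdd_above X\<close> \<open>bdd_below X\<close>] by simp_all
    qed
    ultimately show ?thesis
      using cong[OF lim AE] L1_step_limit_cong_AE[OF lim AE] h_zero by simp
  qed
  have step: "\<Phi> g = 0" if g: "step_function s t g" for g
  proof -
    obtain \<X> :: "real set set" and k where \<X>: "finite \<X>" "\<And>X. X \<in> \<X> \<Longrightarrow> is_interval X \<and> X \<subseteq> {s..t}"
      and g_eq: "\<And>x. x \<in> {s..t} \<Longrightarrow> g x = (\<Sum>X\<in>\<X>. k X * indicator X x)"
      using g unfolding step_function_def by blast
    have "\<Phi> (\<lambda>x. \<Sum>X\<in>\<X>. k X * indicator X x) = 0
        \<and> L1_step_limit s t (\<lambda>x. \<Sum>X\<in>\<X>. k X * indicator X x)"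
      using \<X>
    proof (induction \<X> rule: finite_induct)
      case empty
      then show ?case
        using zero L1_step_limit_zero by simp
    next
      case (insert X \<X>)
      have IH: "\<Phi> (\<lambda>x. \<Sum>X\<in>\<X>. k X * indicator X x) = 0"
          "L1_step_limit s t (\<lambda>x. \<Sum>X\<in>\<X>. k X * indicator X x)"
        using insert.IH insert.prems by blast+
      have X: "L1_step_limit s t (indicator X)" "\<Phi> (indicator X) = 0"
        using interval[of X] insert.prems by blast+
      show ?case
        unfolding sum.insert[OF insert.hyps] add[OF L1_step_limit_scale[OF X(1)] IH(2)] scale[OF X(1)]
        using X(2) IH(1) L1_step_limit_add[OF L1_step_limit_scale[OF X(1)] IH(2)]
        by (simp only: mult_zero_right add_0_left simp_thms)
    qed
    moreover have "AE x in lebesgue_on {s..t}. g x = (\<Sum>X\<in>\<X>. k X * indicator X x)"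
      by (rule AE_I2) (simp add: g_eq)
    ultimately show ?thesis
      using cong[OF L1_step_limit_step[OF g]] by simp
  qed
  have "\<bar>\<Phi> f\<bar> \<le> e" if "e > 0" for e
  proof -
    obtain g where g: "step_function s t g" "(\<integral>x. \<bar>f x - g x\<bar> \<partial>lebesgue_on {s..t}) < e / C"
      using f \<open>e > 0\<close> \<open>C > 0\<close> unfolding L1_step_limit_def by (meson divide_pos_pos)
    note g_lim = L1_step_limit_scale[OF L1_step_limit_step[OF g(1)], of "- 1"]
    have "\<Phi> f = \<Phi> (\<lambda>x. f x + - 1 * g x)"
      by (subst add[OF f g_lim], subst scale[OF L1_step_limit_step[OF g(1)]]) (simp add: step[OF g(1)])
    then have "\<bar>\<Phi> f\<bar> \<le> C * (\<integral>x. \<bar>f x - g x\<bar> \<partial>lebesgue_on {s..t})"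
      using bound[OF L1_step_limit_add[OF f g_lim]] by simp
    also have "\<dots> \<le> e"
      using g(2) \<open>C > 0\<close> by (simp add: field_simps)
    finally show ?thesis .
  qed
  then have "\<bar>\<Phi> f\<bar> \<le> 0"
    by (rule field_le_epsilon) simp
  then show ?thesis
    by (simp add: \<Phi>_def)
qed

lemma integral_in_A1_hom:
  assumes "s \<le> t"
  shows "restrict (L_int s t) (Shat s t) \<in> A1_hom s t (Shat_obj s t) (real_obj s t)"
proof -
  have L_int: "L_int s t (ae_class s t f) = (\<integral>x. f x \<partial>lebesgue_on {s..t})" if "L1_step_limit s t f" for f
    using that by (simp add: L_int_def integral_rep_ae_class(1) L1_step_limit_integrable)
  have closed: "cl_add s t F G \<in> Shat s t" "cl_scale s t k F \<in> Shat s t" "nglue (Shat_obj s t) F G \<in> Shat s t"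
    if "F \<in> Shat s t" "G \<in> Shat s t" for F G k
    using real_vector_space_Shat[of s t] A1_obj_Shat[OF assms] that
    by (simp_all add: real_vector_space_rec_def A1_obj_def)
  have add: "L_int s t (cl_add s t F G) = L_int s t F + L_int s t G"
    if "F \<in> Shat s t" "G \<in> Shat s t" for F G
    using that by (auto elim!: Shat_cases
        simp: L_int cl_add_ae_class L1_step_limit_add L1_step_limit_integrable)
  have scale: "L_int s t (cl_scale s t k F) = k * L_int s t F" if "F \<in> Shat s t" for F k
    using that by (auto elim!: Shat_cases simp: L_int cl_scale_ae_class L1_step_limit_scale)
  have glue: "L_int s t (nglue (Shat_obj s t) F G) = (L_int s t F + L_int s t G) / 2"
    if "F \<in> Shat s t" "G \<in> Shat s t" for F G
    using that by (auto elim!: Shat_cases simp: L_int nglue_Shat_ae_class[OF assms]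
        L1_step_limit_juxtapose[OF assms] integral_juxtapose(2)[OF assms] L1_step_limit_integrable)
  have point: "L_int s t (ae_class s t (indicator {s..t})) = t - s"
    using integral_indicator_Icc[of s t s t] assms by (simp add: L_int L1_step_limit_indicator)
  have bound: "\<bar>L_int s t F\<bar> \<le> 1 * (\<integral>x. \<bar>rep F x\<bar> \<partial>lebesgue_on {s..t})" for F
    unfolding L_int_def by simp
  show ?thesis
    unfolding A1_hom_def
    using A1_obj_Shat[OF assms] A1_obj_real[OF assms] closed add scale glue point
      ae_class_in_Shat[OF L1_step_limit_indicator]
    by (simp, intro exI[of _ 1]) (use bound in simp)
qed

lemma T_hat_eq_L_int:
  assumes "s \<le> t" and "F \<in> Shat s t"
  shows "T_hat s t F = L_int s t F"
proof -
  have "T_hat s t = restrict (L_int s t) (Shat s t)"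
    unfolding T_hat_def
  proof (rule the_equality)
    fix \<theta> assume \<theta>: "\<theta> \<in> A1_hom s t (Shat_obj s t) (real_obj s t)"
    show "\<theta> = restrict (L_int s t) (Shat s t)"
    proof (rule extensionalityI)
      show "\<theta> \<in> extensional (Shat s t)"
        using \<theta> by (auto simp: A1_hom_def PiE_def)
      show "\<theta> G = restrict (L_int s t) (Shat s t) G" if "G \<in> Shat s t" for G
        using that A1_hom_Shat_eq_integral[OF assms(1) \<theta>]
          A1_hom_Shat_eq_integral[OF assms(1) integral_in_A1_hom[OF assms(1)]]
        by (metis Shat_cases)
    qed simp
  qed (rule integral_in_A1_hom[OF assms(1)])
  then show ?thesis
    using assms(2) by simp
qed

section \<open>Additivity and linearity\<close>

lemma T_sub_ae_class:
  assumes "s \<le> t" and "{s..t} \<subseteq> {c..d}" and f: "L1_step_limit c d f"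
  shows "T_sub s t (ae_class c d f) = (\<integral>x. f x \<partial>lebesgue_on {s..t})"
proof -
  have f': "L1_step_limit s t f"
    using L1_step_limit_subinterval[OF f assms(2)] .
  show ?thesis
    unfolding T_sub_def cl_restrict_ae_class[OF assms(2)] T_hat_eq_L_int[OF assms(1) ae_class_in_Shat[OF f']]
    using f' by (simp add: L_int_def integral_rep_ae_class(1) L1_step_limit_integrable)
qed

lemma integral_combine_Icc:
  fixes f :: "real \<Rightarrow> real"
  assumes "a \<le> b" and "b \<le> e" and f: "integrable (lebesgue_on {a..e}) f"
  shows "(\<integral>x. f x \<partial>lebesgue_on {a..b}) + (\<integral>x. f x \<partial>lebesgue_on {b..e}) = (\<integral>x. f x \<partial>lebesgue_on {a..e})"
proof -
  have int: "integrable lebesgue (\<lambda>x. indicator {a..b} x *\<^sub>R f x)" "integrable lebesgue (\<lambda>x. indicator {b..e} x *\<^sub>R f x)"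
    using integrable_subinterval[OF f, of a b] integrable_subinterval[OF f, of b e] assms(1,2)
    by (simp_all add: integrable_restrict_space)
  have sum_int: "integrable lebesgue (\<lambda>x. indicator {a..b} x *\<^sub>R f x + indicator {b..e} x *\<^sub>R f x)"
    using int by (rule Bochner_Integration.integrable_add)
  have "AE x in lebesgue. x \<noteq> b"
    by (rule AE_lebesgue_neq)
  then have AE: "AE x in lebesgue. indicator {a..b} x *\<^sub>R f x + indicator {b..e} x *\<^sub>R f x = indicator {a..e} x *\<^sub>R f x"
    by eventually_elim (use assms(1,2) in \<open>auto simp: indicator_def\<close>)
  show ?thesis
    using integrable_cong_AE_lebesgue(2)[OF sum_int AE] Bochner_Integration.integral_add[OF int]
    by (simp add: integral_restrict_space)
qed

lemma G_map_S_union: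
  assumes "F \<in> Shat c d" and "\<alpha> \<le> t" and "t \<le> d"
  shows "(F, t, L_int \<alpha> t F) \<in> S_union c d \<alpha>"
    and "G_map c d \<alpha> (F, t, L_int \<alpha> t F) = (F, {\<alpha>..t}, T_sub \<alpha> t F)"
proof -
  show mem: "(F, t, L_int \<alpha> t F) \<in> S_union c d \<alpha>"
    using assms by (simp add: S_union_def S_fib_def)
  then show "G_map c d \<alpha> (F, t, L_int \<alpha> t F) = (F, {\<alpha>..t}, T_sub \<alpha> t F)"
    by (simp add: G_map_def)
qed

text \<open>
  The restricted map takes its intended value only inside the image of \<open>G_map\<close>, and is
  undefined elsewhere.  Membership in that image forces the third component to be
  \<open>T_sub \<alpha> t F\<close>, and every such triple occurs.
\<close>

lemma G_nat_res_apply: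
  assumes "F \<in> Shat c d" and "\<alpha> \<le> t" and "t \<le> d"
  shows "G_nat_res c d \<alpha> (F, {\<alpha>..t}, T_sub \<alpha> t F) = ({c..d}, T_sub \<alpha> t F)"
proof -
  have "(F, {\<alpha>..t}, T_sub \<alpha> t F) \<in> G_map c d \<alpha> ` S_union c d \<alpha>"
    using G_map_S_union[OF assms] by (metis imageI)
  then show ?thesis
    by (simp add: G_nat_res_def G_nat_def)
qed

theorem theorem1p2:
  fixes c d \<alpha> :: real
  assumes "c < d" and "\<alpha> \<in> {c..d}"
  shows
    "(\<forall>F\<in>Shat c d. \<forall>\<beta> \<gamma>.
        (\<beta>, L_int \<alpha> \<beta> F) \<in> S_fib d \<alpha> F \<and> \<beta> \<le> \<gamma> \<and> \<gamma> \<le> d \<longrightarrow>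
        top_add c d
          ((G_nat c d \<circ> G_map c d \<alpha>) (F, \<beta>, L_int \<alpha> \<beta> F))
          ((G_nat c d \<circ> G_map c d \<beta>) (F, \<gamma>, L_int \<beta> \<gamma> F))
        = (G_nat c d \<circ> G_map c d \<alpha>) (F, \<gamma>, L_int \<alpha> \<gamma> F)) \<and>
     (\<forall>F\<in>Shat c d. \<forall>G\<in>Shat c d. \<forall>\<beta> k1 k2.
        (\<beta>, L_int \<alpha> \<beta> F) \<in> S_fib d \<alpha> F \<and> (\<beta>, L_int \<alpha> \<beta> G) \<in> S_fib d \<alpha> G \<longrightarrow>
        G_nat_res c d \<alpha>
          (pair_add c d
            (pair_scale c d k1 (G_map c d \<alpha> (F, \<beta>, L_int \<alpha> \<beta> F)))
            (pair_scale c d k2 (G_map c d \<alpha> (G, \<beta>, L_int \<alpha> \<beta> G))))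
        = top_add c d
            (top_scale c d k1 ((G_nat_res c d \<alpha> \<circ> G_map c d \<alpha>) (F, \<beta>, L_int \<alpha> \<beta> F)))
            (top_scale c d k2 ((G_nat_res c d \<alpha> \<circ> G_map c d \<alpha>) (G, \<beta>, L_int \<alpha> \<beta> G))))"
proof (intro conjI ballI allI impI)
  fix F \<beta> \<gamma>
  assume F: "F \<in> Shat c d" and *: "(\<beta>, L_int \<alpha> \<beta> F) \<in> S_fib d \<alpha> F \<and> \<beta> \<le> \<gamma> \<and> \<gamma> \<le> d"
  then have le: "c \<le> \<alpha>" "\<alpha> \<le> \<beta>" "\<beta> \<le> \<gamma>" "\<gamma> \<le> d"
    using assms by (auto simp: S_fib_def)
  obtain f where f: "L1_step_limit c d f" "F = ae_class c d f"
    using F by (rule Shat_cases)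
  have "integrable (lebesgue_on {\<alpha>..\<gamma>}) f"
    using integrable_subinterval[OF L1_step_limit_integrable[OF f(1)]] le by simp
  then have "T_sub \<alpha> \<beta> F + T_sub \<beta> \<gamma> F = T_sub \<alpha> \<gamma> F"
    using le integral_combine_Icc[of \<alpha> \<beta> \<gamma> f] by (simp add: f(2) T_sub_ae_class[OF _ _ f(1)])
  then show "top_add c d
      ((G_nat c d \<circ> G_map c d \<alpha>) (F, \<beta>, L_int \<alpha> \<beta> F))
      ((G_nat c d \<circ> G_map c d \<beta>) (F, \<gamma>, L_int \<beta> \<gamma> F))
    = (G_nat c d \<circ> G_map c d \<alpha>) (F, \<gamma>, L_int \<alpha> \<gamma> F)"
    using le F by (simp add: G_map_S_union(2) G_nat_def top_add_def)
next
  fix F G \<beta> k1 k2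
  assume F: "F \<in> Shat c d" and G: "G \<in> Shat c d"
    and "(\<beta>, L_int \<alpha> \<beta> F) \<in> S_fib d \<alpha> F \<and> (\<beta>, L_int \<alpha> \<beta> G) \<in> S_fib d \<alpha> G"
  then have le: "c \<le> \<alpha>" "\<alpha> \<le> \<beta>" "\<beta> \<le> d"
    using assms by (auto simp: S_fib_def)
  then have sub: "{\<alpha>..\<beta>} \<subseteq> {c..d}"
    by auto
  obtain f where f: "L1_step_limit c d f" "F = ae_class c d f"
    using F by (rule Shat_cases)
  obtain g where g: "L1_step_limit c d g" "G = ae_class c d g"
    using G by (rule Shat_cases)
  define h where "h x = indicator {\<alpha>..\<beta>} x * (k1 * f x) + indicator {\<alpha>..\<beta>} x * (k2 * g x)" for x
  define H where "H = cl_add c d (cl_cut c d {\<alpha>..\<beta>} (cl_scale c d k1 F)) (cl_cut c d {\<alpha>..\<beta>} (cl_scale c d k2 G))"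
  have H_eq: "H = ae_class c d h"
    by (simp add: H_def f(2) g(2) cl_scale_ae_class cl_cut_ae_class cl_add_ae_class h_def[abs_def])
  have h: "L1_step_limit c d h"
    unfolding h_def[abs_def]
    by (intro L1_step_limit_add L1_step_limit_cut L1_step_limit_scale f(1) g(1))
  have "T_sub \<alpha> \<beta> H = (\<integral>x. h x \<partial>lebesgue_on {\<alpha>..\<beta>})"
    unfolding H_eq by (rule T_sub_ae_class[OF le(2) sub h])
  also have "\<dots> = (\<integral>x. k1 * f x + k2 * g x \<partial>lebesgue_on {\<alpha>..\<beta>})"
    by (rule Bochner_Integration.integral_cong) (simp_all add: h_def)
  also have "\<dots> = k1 * T_sub \<alpha> \<beta> F + k2 * T_sub \<alpha> \<beta> G"
    using L1_step_limit_integrable[OF L1_step_limit_subinterval[OF f(1) sub]]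
      L1_step_limit_integrable[OF L1_step_limit_subinterval[OF g(1) sub]]
    by (simp add: f(2) g(2) T_sub_ae_class[OF le(2) sub] f(1) g(1))
  finally have T_H: "T_sub \<alpha> \<beta> H = k1 * T_sub \<alpha> \<beta> F + k2 * T_sub \<alpha> \<beta> G" .
  \<comment> \<open>The sum is again indexed by the class of a limit of step functions, so it lies in the image of \<open>G_map\<close>.\<close>
  have H: "H \<in> Shat c d"
    unfolding H_eq by (rule ae_class_in_Shat[OF h])
  have "pair_add c d
      (pair_scale c d k1 (G_map c d \<alpha> (F, \<beta>, L_int \<alpha> \<beta> F)))
      (pair_scale c d k2 (G_map c d \<alpha> (G, \<beta>, L_int \<alpha> \<beta> G)))
    = (H, {\<alpha>..\<beta>}, T_sub \<alpha> \<beta> H)"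
    using le by (simp add: G_map_S_union(2) F G pair_scale_def pair_add_def H_def Let_def)
  then show "G_nat_res c d \<alpha>
      (pair_add c d
        (pair_scale c d k1 (G_map c d \<alpha> (F, \<beta>, L_int \<alpha> \<beta> F)))
        (pair_scale c d k2 (G_map c d \<alpha> (G, \<beta>, L_int \<alpha> \<beta> G))))
    = top_add c d
        (top_scale c d k1 ((G_nat_res c d \<alpha> \<circ> G_map c d \<alpha>) (F, \<beta>, L_int \<alpha> \<beta> F)))
        (top_scale c d k2 ((G_nat_res c d \<alpha> \<circ> G_map c d \<alpha>) (G, \<beta>, L_int \<alpha> \<beta> G)))"
    using le G_nat_res_apply[OF H le(2,3)]
    by (simp add: G_map_S_union(2) G_nat_res_apply F G T_H top_add_def top_scale_def)
qed

end
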